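(* For every skew shape $\lambda/\mu$ and every positive integer $i$, there exists an involution $\Phi_i$ on $\mathrm{SVRPP}(\lambda/\mu)$ such that for all $T$: $\mathrm{ceq}(\Phi_i(T))=\mathrm{ceq}(T)$, $\mathrm{ex}(\Phi_i(T))=\mathrm{ex}(T)$, and $\mathrm{ircont}(\Phi_i(T))$ is obtained from $\mathrm{ircont}(T)$ by exchanging its $i$-th and $(i+1)$-th entries.
   Context: Boxes are $(i,j)$ (row $i$, column $j$); $\lambda/\mu$ is the skew diagram. $\mathrm{SVRPP}(\lambda/\mu)$ is the set of fillings $T$ of $\lambda/\mu$ by nonempty finite sets $T(a,b)$ of positive integers, weakly increasing along rows and down columns, where $A\le B$ means $\max A\le\min B$. $\mathrm{ircont}(T)=(r_1,r_2,\ldots)$, $r_k$ = number of columns containing a box whose set contains $k$; $\mathrm{ceq}(T)=(c_1,c_2,\ldots)$, $c_a$ = number of boxes $(a,b)$ with $(a+1,b)\in\lambda/\mu$ and $\max T(a,b)=\min T(a+1,b)$; $\mathrm{ex}(T)=(e_1,e_2,\ldots)$, $e_a=\sum_{(a,b)\in\lambda/\mu}(|T(a,b)|-1)$. *)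

theory Defs
  imports "HOL-Library.FuncSet"
begin

text \<open>
  A partition is the weakly decreasing list of its positive parts. Boxes are pairs
  (row, column), both counted from 1, so row \<open>i\<close> of the diagram has length \<open>lam ! (i - 1)\<close>.
\<close>

definition is_partition :: "nat list \<Rightarrow> bool" where
  "is_partition lam \<longleftrightarrow> sorted_wrt (\<ge>) lam \<and> 0 \<notin> set lam"

definition diagram :: "nat list \<Rightarrow> (nat \<times> nat) set" where
  "diagram lam = {(i, j). 1 \<le> i \<and> i \<le> length lam \<and> 1 \<le> j \<and> j \<le> lam ! (i - 1)}"

definition is_skew_shape :: "nat list \<Rightarrow> nat list \<Rightarrow> bool" where
  "is_skew_shape lam mu \<longleftrightarrow>
     is_partition lam \<and> is_partition mu \<and> diagram mu \<subseteq> diagram lam"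

definition skew_diagram :: "nat list \<Rightarrow> nat list \<Rightarrow> (nat \<times> nat) set" where
  "skew_diagram lam mu = diagram lam - diagram mu"

definition set_le :: "nat set \<Rightarrow> nat set \<Rightarrow> bool" where
  "set_le A B \<longleftrightarrow> Max A \<le> Min B"

text \<open>
  Fillings are extensional functions on the boxes, so that equality of functions is
  equality of fillings. Monotonicity compares distinct boxes only: \<open>set_le\<close> is not
  reflexive on sets with more than one element.
\<close>

definition SVRPP :: "(nat \<times> nat) set \<Rightarrow> (nat \<times> nat \<Rightarrow> nat set) set" where
  "SVRPP D = {T \<in> D \<rightarrow>\<^sub>E {A. finite A \<and> A \<noteq> {} \<and> (\<forall>k\<in>A. 1 \<le> k)}.
     (\<forall>a b b'. (a, b) \<in> D \<and> (a, b') \<in> D \<and> b < b' \<longrightarrow> set_le (T (a, b)) (T (a, b'))) \<and>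
     (\<forall>a a' b. (a, b) \<in> D \<and> (a', b) \<in> D \<and> a < a' \<longrightarrow> set_le (T (a, b)) (T (a', b)))}"

text \<open>
  The statistics below are sequences indexed from 1; for \<open>T \<in> SVRPP D\<close> on a (skew) diagram
  \<open>D\<close> their value at index 0 is 0.
\<close>

definition ircont :: "(nat \<times> nat) set \<Rightarrow> (nat \<times> nat \<Rightarrow> nat set) \<Rightarrow> nat \<Rightarrow> nat" where
  "ircont D T k = card {b. \<exists>a. (a, b) \<in> D \<and> k \<in> T (a, b)}"

definition ceq :: "(nat \<times> nat) set \<Rightarrow> (nat \<times> nat \<Rightarrow> nat set) \<Rightarrow> nat \<Rightarrow> nat" where
  "ceq D T a = card {b. (a, b) \<in> D \<and> (a + 1, b) \<in> D \<and> Max (T (a, b)) = Min (T (a + 1, b))}"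

definition ex :: "(nat \<times> nat) set \<Rightarrow> (nat \<times> nat \<Rightarrow> nat set) \<Rightarrow> nat \<Rightarrow> nat" where
  "ex D T a = (\<Sum>b | (a, b) \<in> D. card (T (a, b)) - 1)"

definition involution_on :: "'a set \<Rightarrow> ('a \<Rightarrow> 'a) \<Rightarrow> bool" where
  "involution_on S f \<longleftrightarrow> f ` S \<subseteq> S \<and> (\<forall>x\<in>S. f (f x) = x)"

end

theory Submission
  imports Defs "HOL-Library.Poly_Mapping" "HOL-Library.Multiset"
begin

text \<open>
  Fix everything about a filling except how the entries \<open>i\<close> and \<open>i + 1\<close> are distributed over the
  boxes that contain at least one of them. These boxes form an order-convex set, so they meet
  column \<open>b\<close> in an interval of rows \<open>top_row b, \<dots>, bottom_row b\<close>, with both ends weakly decreasing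
  in \<open>b\<close>. A column is described by one number \<open>\<kappa> b\<close>, the place where it switches from \<open>i\<close> to
  \<open>i + 1\<close>: an odd key \<open>2 a + 1\<close> means that row \<open>a\<close> contains both entries, an even key \<open>2 a\<close> that
  the switch happens between rows \<open>a - 1\<close> and \<open>a\<close>. The keys range over \<open>lo b = 2 top_row b\<close> (only
  \<open>i + 1\<close>) up to \<open>hi b = 2 bottom_row b + 2\<close> (only \<open>i\<close>), and the row conditions say exactly
  that \<open>\<kappa>\<close> is weakly decreasing and takes each odd value at most once. The statistics ceq and ex
  depend only on the multiset of keys strictly between their bounds, so what is needed is an
  involution on weakly decreasing sequences that preserves this multiset and exchanges the number
  of lower and upper extremal keys. Its existence is a symmetry of a generating function, proved
  by adding one column at a time.
\<close>

subsection \<open>Decreasing sequences between two decreasing bounds\<close>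

text \<open>The threshold \<open>t\<close> serves the recursion over columns: the last column
  carries the smallest value, and once it is removed, that value is the threshold for the
  others.\<close>

definition decr_seqs :: "nat set \<Rightarrow> (nat \<Rightarrow> nat) \<Rightarrow> (nat \<Rightarrow> nat) \<Rightarrow> nat \<Rightarrow> (nat \<Rightarrow> nat) set" where
  "decr_seqs C lo hi t =
     {\<kappa> \<in> C \<rightarrow>\<^sub>E UNIV. (\<forall>b\<in>C. lo b \<le> \<kappa> b \<and> \<kappa> b \<le> hi b \<and> t \<le> \<kappa> b) \<and>
       (\<forall>b\<in>C. \<forall>b'\<in>C. b < b' \<longrightarrow> \<kappa> b' \<le> \<kappa> b)}"

definition decr_sum ::
    "nat set \<Rightarrow> (nat \<Rightarrow> nat) \<Rightarrow> (nat \<Rightarrow> nat) \<Rightarrow> (nat \<Rightarrow> nat \<Rightarrow> 'r::comm_ring_1) \<Rightarrow> nat \<Rightarrow> 'r" where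
  "decr_sum C lo hi w t = (\<Sum>\<kappa>\<in>decr_seqs C lo hi t. \<Prod>b\<in>C. w b (\<kappa> b))"

text \<open>The interior weight depends on the value alone and not on the column, so a product of
  weights records the multiset of interior keys together with the numbers of upper and lower
  extremal ones.\<close>

definition end_weight ::
    "(nat \<Rightarrow> nat) \<Rightarrow> (nat \<Rightarrow> nat) \<Rightarrow> 'r \<Rightarrow> 'r \<Rightarrow> (nat \<Rightarrow> 'r) \<Rightarrow> nat \<Rightarrow> nat \<Rightarrow> 'r" where
  "end_weight lo hi x y z b k = (if k = hi b then x else if k = lo b then y else z k)"

lemma finite_decr_seqs:
  assumes "finite C"
  shows "finite (decr_seqs C lo hi t)"
proof (rule finite_subset)
  show "decr_seqs C lo hi t \<subseteq> (\<Pi>\<^sub>E b\<in>C. {..hi b})"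
    by (auto simp: decr_seqs_def PiE_iff extensional_def)
qed (use assms in \<open>simp add: finite_PiE\<close>)

section \<open>Recursion in the last column\<close>

lemma decr_seqs_insertD:
  assumes "\<kappa> \<in> decr_seqs (insert b C) lo hi t" "\<forall>c\<in>C. c < b"
  shows "\<kappa> b \<in> {max t (lo b)..hi b}" "restrict \<kappa> C \<in> decr_seqs C lo hi (\<kappa> b)"
  using assms unfolding decr_seqs_def by (auto simp: PiE_iff)

lemma decr_seqs_insertI:
  assumes "\<kappa> \<in> decr_seqs C lo hi k" "\<forall>c\<in>C. c < b" "k \<in> {max t (lo b)..hi b}"
  shows "\<kappa>(b := k) \<in> decr_seqs (insert b C) lo hi t"
proof -
  have "b \<notin> C" using assms(2) by auto
  then show ?thesis
    using assms unfolding decr_seqs_def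
    by (force simp: PiE_iff extensional_def)
qed

text \<open>Sort the sequences by their value \<open>k\<close> in the last column \<open>b\<close>;
  what remains is a sequence with threshold \<open>k\<close>.\<close>

lemma decr_sum_insert:
  fixes w :: "nat \<Rightarrow> nat \<Rightarrow> 'r::comm_ring_1"
  assumes fin: "finite C" and less: "\<forall>c\<in>C. c < b"
  shows "decr_sum (insert b C) lo hi w t =
    (\<Sum>k\<in>{max t (lo b)..hi b}. w b k * decr_sum C lo hi w k)"
proof -
  have nb: "b \<notin> C" using less by auto
  have "(\<Sum>k\<in>{max t (lo b)..hi b}. w b k * decr_sum C lo hi w k) =
     (\<Sum>k\<in>{max t (lo b)..hi b}. \<Sum>\<kappa>\<in>decr_seqs C lo hi k. w b k * (\<Prod>c\<in>C. w c (\<kappa> c)))"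
    by (simp add: decr_sum_def sum_distrib_left)
  also have "\<dots> = (\<Sum>(k, \<kappa>)\<in>(SIGMA k:{max t (lo b)..hi b}. decr_seqs C lo hi k).
      w b k * (\<Prod>c\<in>C. w c (\<kappa> c)))"
    by (rule sum.Sigma) (auto simp: finite_decr_seqs fin)
  also have "\<dots> = decr_sum (insert b C) lo hi w t"
    unfolding decr_sum_def
  proof (rule sum.reindex_bij_witness
      [where i = "\<lambda>\<kappa>. (\<kappa> b, restrict \<kappa> C)" and j = "\<lambda>(k, \<kappa>). \<kappa>(b := k)"])
    fix q assume q: "q \<in> (SIGMA k:{max t (lo b)..hi b}. decr_seqs C lo hi k)"
    obtain k \<kappa> where kk: "q = (k, \<kappa>)" by (cases q)
    have ext: "\<kappa> \<in> extensional C" using q kk unfolding decr_seqs_def by (auto simp: PiE_iff)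
    have "restrict (\<kappa>(b := k)) C = \<kappa>"
      by (rule extensionalityI[OF restrict_extensional ext]) (use nb in auto)
    then show "(\<lambda>\<kappa>. (\<kappa> b, restrict \<kappa> C)) ((\<lambda>(k, \<kappa>). \<kappa>(b := k)) q) = q"
      by (simp add: kk)
    show "(\<lambda>(k, \<kappa>). \<kappa>(b := k)) q \<in> decr_seqs (insert b C) lo hi t"
      using decr_seqs_insertI[OF _ less] q kk by auto
    have "(\<Prod>c\<in>C. w c ((\<kappa>(b := k)) c)) = (\<Prod>c\<in>C. w c (\<kappa> c))"
      using nb by (intro prod.cong) auto
    then show "(\<Prod>c\<in>insert b C. w c ((\<lambda>(k, \<kappa>). \<kappa>(b := k)) q c)) =
        (case q of (k, \<kappa>) \<Rightarrow> w b k * (\<Prod>c\<in>C. w c (\<kappa> c)))"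
      using fin nb by (simp add: kk)
  next
    fix \<kappa> assume k: "\<kappa> \<in> decr_seqs (insert b C) lo hi t"
    then have ext: "\<kappa> \<in> extensional (insert b C)" unfolding decr_seqs_def by (auto simp: PiE_iff)
    show "(\<lambda>(k, \<kappa>). \<kappa>(b := k)) ((\<lambda>\<kappa>. (\<kappa> b, restrict \<kappa> C)) \<kappa>) = \<kappa>"
      using ext by (auto simp: fun_eq_iff extensional_def)
    show "(\<lambda>\<kappa>. (\<kappa> b, restrict \<kappa> C)) \<kappa> \<in> (SIGMA k:{max t (lo b)..hi b}. decr_seqs C lo hi k)"
      using decr_seqs_insertD[OF k less] by simp
  qed
  finally show ?thesis by simp
qed

lemma decr_sum_below:
  assumes "\<forall>b\<in>C. t \<le> lo b" "\<forall>b\<in>C. t' \<le> lo b"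
  shows "decr_sum C lo hi w t = decr_sum C lo hi w t'"
proof -
  have "decr_seqs C lo hi t = decr_seqs C lo hi t'"
    using assms unfolding decr_seqs_def by (force intro: order_trans)
  then show ?thesis by (simp add: decr_sum_def)
qed

text \<open>
  \<open>U t\<close> is the divided difference, under exchanging \<open>x\<close> and \<open>y\<close>, of the generating function
  of the sequences with all values at least \<open>t\<close>. The third clause is what makes the induction
  work: adding a column \<open>b\<close> turns \<open>U t\<close> into the sum \<open>decr_sum \<dots> t + y * U t\<close> for
  \<open>t\<close> above \<open>lo b\<close>, and into 0 below.
\<close>

definition is_defect ::
    "nat set \<Rightarrow> (nat \<Rightarrow> nat) \<Rightarrow> (nat \<Rightarrow> nat) \<Rightarrow> 'r::comm_ring_1 \<Rightarrow> 'r \<Rightarrow> (nat \<Rightarrow> 'r) \<Rightarrow> (nat \<Rightarrow> 'r) \<Rightarrow> bool" where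
  "is_defect C lo hi x y z U \<longleftrightarrow>
    (\<forall>t. (\<forall>b\<in>C. t \<le> lo b) \<longrightarrow> U t = 0) \<and>
    (\<forall>t. (\<forall>b\<in>C. t \<le> hi b) \<longrightarrow>
      decr_sum C lo hi (end_weight lo hi x y z) t - decr_sum C lo hi (end_weight lo hi y x z) t =
        (x - y) * U t) \<and>
    (\<forall>L h. (\<forall>b\<in>C. L \<le> lo b \<and> h \<le> hi b) \<longrightarrow> L \<le> h \<longrightarrow>
      decr_sum C lo hi (end_weight lo hi x y z) h + y * U h + (\<Sum>k\<in>{L<..<h}. z k * U k) =
        decr_sum C lo hi (end_weight lo hi x y z) L)"

text \<open>Once the recursions for both weightings are written in terms of \<open>G\<close> and
  \<open>U\<close>, the factor \<open>x - y\<close> splits off. The third clause for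
  \<open>U\<close> evaluates the other factor: it is 0 for \<open>t\<close> up to
  \<open>lo b\<close> and \<open>G C t + y * U t\<close> above.\<close>

lemma is_defect_insert:
  fixes x y :: "'r::comm_ring_1" and z :: "nat \<Rightarrow> 'r"
  assumes fin: "finite C" and less: "\<forall>c\<in>C. c < b" and lohi: "lo b < hi b"
    and loC: "\<forall>c\<in>C. lo b \<le> lo c" and hiC: "\<forall>c\<in>C. hi b \<le> hi c"
    and U: "is_defect C lo hi x y z U"
  shows "\<exists>V. is_defect (insert b C) lo hi x y z V"
proof -
  define G where "G C = decr_sum C lo hi (end_weight lo hi x y z)" for C
  define G' where "G' C = decr_sum C lo hi (end_weight lo hi y x z)" for C
  have U0: "\<And>t. (\<forall>b\<in>C. t \<le> lo b) \<Longrightarrow> U t = 0" and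
    U1: "\<And>t. (\<forall>b\<in>C. t \<le> hi b) \<Longrightarrow> G C t - G' C t = (x - y) * U t" and
    U2: "\<And>L h. (\<forall>b\<in>C. L \<le> lo b \<and> h \<le> hi b) \<Longrightarrow> L \<le> h \<Longrightarrow>
       G C h + y * U h + (\<Sum>k\<in>{L<..<h}. z k * U k) = G C L"
    using U unfolding is_defect_def G_def G'_def by blast+
  have split1: "{t..hi b} = insert (hi b) {t..<hi b}" if "t \<le> hi b" for t using that by auto
  have split2: "{lo b..hi b} = insert (lo b) (insert (hi b) {lo b<..<hi b})" using lohi by auto
  \<comment> \<open>For \<open>t\<close> above \<open>lo b\<close> the new column cannot attain its
    lower bound, so \<open>v\<close> enters only through the columns of \<open>C\<close>.\<close>
  have rec_mid: "decr_sum (insert b C) lo hi (end_weight lo hi u v z) t =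
      u * decr_sum C lo hi (end_weight lo hi u v z) (hi b) +
      (\<Sum>k\<in>{t..<hi b}. z k * decr_sum C lo hi (end_weight lo hi u v z) k)"
    if "lo b < t" "t \<le> hi b" for u v t
  proof -
    let ?g = "decr_sum C lo hi (end_weight lo hi u v z)"
    have "decr_sum (insert b C) lo hi (end_weight lo hi u v z) t =
        (\<Sum>k\<in>insert (hi b) {t..<hi b}. end_weight lo hi u v z b k * ?g k)"
      unfolding decr_sum_insert[OF fin less] split1[OF that(2), symmetric]
      using that by simp
    also have "\<dots> = end_weight lo hi u v z b (hi b) * ?g (hi b) +
        (\<Sum>k\<in>{t..<hi b}. end_weight lo hi u v z b k * ?g k)"
      by (rule sum.insert) auto
    also have "(\<Sum>k\<in>{t..<hi b}. end_weight lo hi u v z b k * ?g k) = (\<Sum>k\<in>{t..<hi b}. z k * ?g k)"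
      using that by (intro sum.cong) (auto simp: end_weight_def)
    also have "end_weight lo hi u v z b (hi b) = u" by (simp add: end_weight_def)
    finally show ?thesis .
  qed
  have rec_low: "decr_sum (insert b C) lo hi (end_weight lo hi u v z) t =
      v * decr_sum C lo hi (end_weight lo hi u v z) (lo b) +
      (u * decr_sum C lo hi (end_weight lo hi u v z) (hi b) +
      (\<Sum>k\<in>{lo b<..<hi b}. z k * decr_sum C lo hi (end_weight lo hi u v z) k))"
    if "t \<le> lo b" for u v t
  proof -
    let ?g = "decr_sum C lo hi (end_weight lo hi u v z)"
    have "decr_sum (insert b C) lo hi (end_weight lo hi u v z) t =
        (\<Sum>k\<in>insert (lo b) (insert (hi b) {lo b<..<hi b}). end_weight lo hi u v z b k * ?g k)"
      unfolding decr_sum_insert[OF fin less] split2[symmetric]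
      using that by (simp add: max_def)
    also have "\<dots> = end_weight lo hi u v z b (lo b) * ?g (lo b) +
        (end_weight lo hi u v z b (hi b) * ?g (hi b) +
        (\<Sum>k\<in>{lo b<..<hi b}. end_weight lo hi u v z b k * ?g k))"
      using lohi by (subst sum.insert, simp, simp)+ (rule refl)
    also have "(\<Sum>k\<in>{lo b<..<hi b}. end_weight lo hi u v z b k * ?g k) = (\<Sum>k\<in>{lo b<..<hi b}. z k * ?g k)"
      by (intro sum.cong) (auto simp: end_weight_def)
    also have "end_weight lo hi u v z b (lo b) = v" using lohi by (simp add: end_weight_def)
    also have "end_weight lo hi u v z b (hi b) = u" by (simp add: end_weight_def)
    finally show ?thesis .
  qed
  \<comment> \<open>The second clause for \<open>U\<close> applies because \<open>hi b\<close> is at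
    most every upper bound in \<open>C\<close>; it eliminates the exchanged weighting.\<close>
  have G'eq: "G' C t = G C t - (x - y) * U t" if "t \<le> hi b" for t
    using U1[of t] that hiC by (metis (no_types, lifting) diff_diff_eq2 add_diff_cancel_left' order_trans)
  have G'sum: "(\<Sum>k\<in>K. z k * G' C k) = (\<Sum>k\<in>K. z k * G C k) - (x - y) * (\<Sum>k\<in>K. z k * U k)"
    if "\<And>k. k \<in> K \<Longrightarrow> k \<le> hi b" for K
    unfolding sum_distrib_left sum_subtractf[symmetric]
    using that by (intro sum.cong) (auto simp: G'eq algebra_simps)
  have Ulo: "U (lo b) = 0" using U0 loC by auto
  have G'lo: "G' C (lo b) = G C (lo b)" using G'eq[of "lo b"] Ulo lohi by simp
  have G'hi: "G' C (hi b) = G C (hi b) - (x - y) * U (hi b)" by (simp add: G'eq)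
  have sum_low: "(\<Sum>k\<in>{lo b<..<hi b}. z k * G' C k) =
      (\<Sum>k\<in>{lo b<..<hi b}. z k * G C k) - (x - y) * (\<Sum>k\<in>{lo b<..<hi b}. z k * U k)"
    by (rule G'sum) simp
  have sum_mid: "(\<Sum>k\<in>{t..<hi b}. z k * G' C k) =
      (\<Sum>k\<in>{t..<hi b}. z k * G C k) - (x - y) * (\<Sum>k\<in>{t..<hi b}. z k * U k)" for t
    by (rule G'sum) simp
  \<comment> \<open>The third clause with \<open>L = lo b\<close>. Comparing its instances at
    \<open>hi b\<close> and at a lower threshold isolates a partial sum.\<close>
  have step: "G C h + y * U h + (\<Sum>k\<in>{lo b<..<h}. z k * U k) = G C (lo b)"
    if "lo b \<le> h" "h \<le> hi b" for h
    using U2[of "lo b" h] that loC hiC by (meson order_trans)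
  define V where "V t = (if t \<le> lo b then 0 else G C t + y * U t)" for t
  have cut: "{lo b<..<hi b} = {lo b<..<t} \<union> {t..<hi b}" "{lo b<..<t} \<inter> {t..<hi b} = {}"
    if "lo b < t" "t \<le> hi b" for t
    using that by auto
  have V1: "G (insert b C) t - G' (insert b C) t = (x - y) * V t" if t: "t \<le> hi b" for t
  proof (cases "t \<le> lo b")
    case True
    have "G (insert b C) t - G' (insert b C) t =
        (y * G C (lo b) + (x * G C (hi b) + (\<Sum>k\<in>{lo b<..<hi b}. z k * G C k))) -
        (x * G' C (lo b) + (y * G' C (hi b) + (\<Sum>k\<in>{lo b<..<hi b}. z k * G' C k)))"
      unfolding G_def G'_def rec_low[OF True] ..
    also have "\<dots> =
        (x - y) * (G C (hi b) + y * U (hi b) + (\<Sum>k\<in>{lo b<..<hi b}. z k * U k) - G C (lo b))"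
      unfolding G'lo G'hi sum_low by (simp add: algebra_simps)
    finally have "G (insert b C) t - G' (insert b C) t =
        (x - y) * (G C (hi b) + y * U (hi b) + (\<Sum>k\<in>{lo b<..<hi b}. z k * U k) - G C (lo b))" .
    then show ?thesis using step[of "hi b"] lohi True by (simp add: V_def)
  next
    case False
    have "G (insert b C) t - G' (insert b C) t =
        (x * G C (hi b) + (\<Sum>k\<in>{t..<hi b}. z k * G C k)) -
        (y * G' C (hi b) + (\<Sum>k\<in>{t..<hi b}. z k * G' C k))"
      using False t unfolding G_def G'_def by (simp only: rec_mid not_le)
    also have "\<dots> = (x - y) * (G C (hi b) + y * U (hi b) + (\<Sum>k\<in>{t..<hi b}. z k * U k))"
      unfolding G'hi sum_mid by (simp add: algebra_simps)
    also have "G C (hi b) + y * U (hi b) + (\<Sum>k\<in>{t..<hi b}. z k * U k) = G C t + y * U t"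
    proof -
      \<comment> \<open>Both sides equal \<open>G C (lo b)\<close>, by \<open>step\<close> at
        \<open>hi b\<close> and at \<open>t\<close>.\<close>
      have "(G C (hi b) + y * U (hi b) + (\<Sum>k\<in>{t..<hi b}. z k * U k)) + (\<Sum>k\<in>{lo b<..<t}. z k * U k) =
          (G C t + y * U t) + (\<Sum>k\<in>{lo b<..<t}. z k * U k)"
        using step[of "hi b"] step[of t] False t cut[of t] lohi
        by (simp add: sum.union_disjoint add_ac)
      then show ?thesis by (rule add_right_imp_eq)
    qed
    finally show ?thesis using False by (simp add: V_def)
  qed
  have V2: "G (insert b C) h + y * V h + (\<Sum>k\<in>{L<..<h}. z k * V k) = G (insert b C) L"
    if L: "L \<le> lo b" and h: "h \<le> hi b" "L \<le> h" for L h
  proof (cases "h \<le> lo b")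
    case True
    have "(\<Sum>k\<in>{L<..<h}. z k * V k) = 0" using True by (intro sum.neutral) (auto simp: V_def)
    moreover have "G (insert b C) h = G (insert b C) L"
      unfolding G_def by (rule decr_sum_below) (use True L loC in auto)
    ultimately show ?thesis using True by (simp add: V_def)
  next
    case False
    have "(\<Sum>k\<in>{L<..<h}. z k * V k) = (\<Sum>k\<in>{lo b<..<h}. z k * V k)"
      using L by (intro sum.mono_neutral_right) (auto simp: V_def)
    also have "\<dots> = (\<Sum>k\<in>{lo b<..<h}. z k * G C k) + y * (\<Sum>k\<in>{lo b<..<h}. z k * U k)"
      unfolding sum_distrib_left sum.distrib[symmetric]
      by (intro sum.cong) (auto simp: V_def algebra_simps)
    finally have s: "(\<Sum>k\<in>{L<..<h}. z k * V k) = \<dots>" .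
    have "G (insert b C) h = x * G C (hi b) + (\<Sum>k\<in>{h..<hi b}. z k * G C k)"
      using False h unfolding G_def by (simp only: rec_mid not_le)
    moreover have "(\<Sum>k\<in>{lo b<..<hi b}. z k * G C k) =
        (\<Sum>k\<in>{lo b<..<h}. z k * G C k) + (\<Sum>k\<in>{h..<hi b}. z k * G C k)"
      using False h cut[of h] by (simp add: sum.union_disjoint)
    moreover have "G (insert b C) L =
        y * G C (lo b) + (x * G C (hi b) + (\<Sum>k\<in>{lo b<..<hi b}. z k * G C k))"
      unfolding G_def rec_low[OF L] ..
    ultimately have "G (insert b C) L =
        G (insert b C) h + y * G C (lo b) + (\<Sum>k\<in>{lo b<..<h}. z k * G C k)"
      by (simp add: add_ac)
    \<comment> \<open>This is \<open>step\<close> at \<open>h\<close>, with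
      \<open>G C h + y * U h\<close> recognised as \<open>V h\<close>.\<close>
    moreover have "G C (lo b) = V h + (\<Sum>k\<in>{lo b<..<h}. z k * U k)"
      using step[of h] False h by (simp add: V_def)
    ultimately show ?thesis
      unfolding s by (simp add: distrib_left add_ac)
  qed
  have "is_defect (insert b C) lo hi x y z V"
    unfolding is_defect_def G_def[symmetric] G'_def[symmetric]
    using V1 V2 by (simp add: V_def)
  then show ?thesis by blast
qed

text \<open>Columns are appended on the right, so each new one has the smallest bounds so far. Over
  no columns the generating function is constantly 1 and the defect is 0.\<close>

lemma ex_is_defect:
  fixes x y :: "'r::comm_ring_1"
  assumes "finite C" "\<forall>b\<in>C. lo b < hi b"
    "\<forall>b\<in>C. \<forall>b'\<in>C. b < b' \<longrightarrow> lo b' \<le> lo b \<and> hi b' \<le> hi b"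
  shows "\<exists>U. is_defect C lo hi x y z U"
  using assms
proof (induction C rule: finite_linorder_max_induct)
  case empty
  have "decr_seqs {} lo hi t = {\<lambda>_. undefined}" for t
    by (auto simp: decr_seqs_def)
  then show ?case
    by (intro exI[of _ "\<lambda>_. 0"]) (simp add: is_defect_def decr_sum_def)
next
  case (insert b C)
  then have "\<exists>U. is_defect C lo hi x y z U" by blast
  then show ?case
    using insert.prems insert.hyps by (elim exE, intro is_defect_insert) auto
qed

text \<open>Threshold 0 lies below every lower bound, so the first clause makes the defect vanish
  there, and with it the difference.\<close>

lemma decr_sum_symmetric:
  fixes x y :: "'r::comm_ring_1" and z :: "nat \<Rightarrow> 'r"
  assumes "finite C" "\<forall>b\<in>C. lo b < hi b"
    "\<forall>b\<in>C. \<forall>b'\<in>C. b < b' \<longrightarrow> lo b' \<le> lo b \<and> hi b' \<le> hi b"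
  shows "decr_sum C lo hi (end_weight lo hi x y z) 0 = decr_sum C lo hi (end_weight lo hi y x z) 0"
proof -
  obtain U where U: "is_defect C lo hi x y z U"
    using ex_is_defect[OF assms] by blast
  then have "U 0 = 0" by (simp add: is_defect_def)
  moreover have "decr_sum C lo hi (end_weight lo hi x y z) 0
      - decr_sum C lo hi (end_weight lo hi y x z) 0 = (x - y) * U 0"
    using U by (simp add: is_defect_def)
  ultimately show ?thesis by simp
qed

section \<open>From a symmetric generating function to an involution\<close>

definition profile :: "nat set \<Rightarrow> (nat \<Rightarrow> nat) \<Rightarrow> (nat \<Rightarrow> nat) \<Rightarrow> bool \<Rightarrow> (nat \<Rightarrow> nat) \<Rightarrow> (bool + nat) multiset" where
  "profile C lo hi s \<kappa> = (\<Sum>b\<in>C. {#end_weight lo hi (Inl s) (Inl (\<not> s)) Inr b (\<kappa> b)#})"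

text \<open>The weights are taken to be indeterminates: in the monoid algebra of multisets over the
  integers, \<open>X r\<close> is the monomial of the single label \<open>r\<close>, and the
  coefficient at \<open>\<nu>\<close> counts the sequences with profile \<open>\<nu>\<close>. The
  labels \<open>Inl\<close> stand for the two kinds of extremal keys, \<open>Inr k\<close> for an
  interior key \<open>k\<close>.\<close>

lemma card_profile_symmetric:
  assumes fin: "finite C" and lohi: "\<forall>b\<in>C. lo b < hi b"
    and anti: "\<forall>b\<in>C. \<forall>b'\<in>C. b < b' \<longrightarrow> lo b' \<le> lo b \<and> hi b' \<le> hi b"
  shows "card {\<kappa> \<in> decr_seqs C lo hi 0. profile C lo hi True \<kappa> = \<nu>} =
    card {\<kappa> \<in> decr_seqs C lo hi 0. profile C lo hi False \<kappa> = \<nu>}"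
proof -
  define X :: "bool + nat \<Rightarrow> (bool + nat) multiset \<Rightarrow>\<^sub>0 int"
    where "X r = Poly_Mapping.single {#r#} 1" for r
  have prod_single: "(\<Prod>b\<in>B. X (g b)) = Poly_Mapping.single (\<Sum>b\<in>B. {#g b#}) 1"
    if "finite B" for B :: "nat set" and g
    using that by induction (auto simp: X_def mult_single)
  have lookup: "Poly_Mapping.lookup (decr_sum C lo hi (end_weight lo hi (X (Inl s)) (X (Inl (\<not> s))) (\<lambda>k. X (Inr k))) 0) \<nu>
      = int (card {\<kappa> \<in> decr_seqs C lo hi 0. profile C lo hi s \<kappa> = \<nu>})" for s
  proof -
    have "end_weight lo hi (X (Inl s)) (X (Inl (\<not> s))) (\<lambda>k. X (Inr k)) b k =
        X (end_weight lo hi (Inl s) (Inl (\<not> s)) Inr b k)" for b k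
      by (simp add: end_weight_def)
    then have "Poly_Mapping.lookup (decr_sum C lo hi (end_weight lo hi (X (Inl s)) (X (Inl (\<not> s))) (\<lambda>k. X (Inr k))) 0) \<nu>
        = (\<Sum>\<kappa>\<in>decr_seqs C lo hi 0. Poly_Mapping.lookup (Poly_Mapping.single (profile C lo hi s \<kappa>) 1) \<nu>)"
      by (simp only: decr_sum_def prod_single[OF fin] Poly_Mapping.lookup_sum profile_def)
    also have "\<dots> = (\<Sum>\<kappa>\<in>decr_seqs C lo hi 0. if profile C lo hi s \<kappa> = \<nu> then 1 else 0)"
      by (simp only: Poly_Mapping.lookup_single when_def)
    also have "\<dots> = (\<Sum>\<kappa>\<in>{\<kappa> \<in> decr_seqs C lo hi 0. profile C lo hi s \<kappa> = \<nu>}. 1)"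
      by (intro sum.inter_filter[symmetric] finite_decr_seqs fin)
    finally show ?thesis by simp
  qed
  have "int (card {\<kappa> \<in> decr_seqs C lo hi 0. profile C lo hi True \<kappa> = \<nu>}) =
      int (card {\<kappa> \<in> decr_seqs C lo hi 0. profile C lo hi False \<kappa> = \<nu>})"
    using decr_sum_symmetric[OF assms, of "X (Inl True)" "X (Inl False)" "\<lambda>k. X (Inr k)"]
      lookup[of True] lookup[of False] by simp
  then show ?thesis by simp
qed

text \<open>The fibres of \<open>w\<close> over \<open>v\<close> and \<open>\<sigma> v\<close> have
  equal size, so a bijection between them exists. On a two-element orbit of \<open>\<sigma>\<close>
  it is used forwards on one fibre and backwards on the other, and \<open>Q\<close> decides which;
  over fixed points of \<open>\<sigma>\<close> the identity is taken.\<close>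

lemma involution_if_card_symmetric:
  fixes w :: "'a \<Rightarrow> 'b"
  assumes fin: "finite A"
    and \<sigma>: "\<And>v. \<sigma> (\<sigma> v) = v"
    and card: "\<And>v. card {a \<in> A. w a = \<sigma> v} = card {a \<in> A. w a = v}"
    and Q: "\<And>v. \<sigma> v \<noteq> v \<Longrightarrow> Q (\<sigma> v) \<longleftrightarrow> \<not> Q v"
  shows "\<exists>f. involution_on A f \<and> (\<forall>a\<in>A. w (f a) = \<sigma> (w a))"
proof -
  define F where "F v = {a \<in> A. w a = v}" for v
  have "\<exists>g. bij_betw g (F v) (F (\<sigma> v))" for v
    using card fin by (intro finite_same_card_bij) (auto simp: F_def)
  then obtain g where g: "\<And>v. bij_betw (g v) (F v) (F (\<sigma> v))" by metis
  define f where "f a = (if \<sigma> (w a) = w a then a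
      else if Q (w a) then g (w a) a
      else inv_into (F (\<sigma> (w a))) (g (\<sigma> (w a))) a)" for a
  have f_in: "f a \<in> F (\<sigma> (w a))" if "a \<in> A" for a
  proof -
    have a: "a \<in> F (w a)" using that by (simp add: F_def)
    have "inv_into (F (\<sigma> (w a))) (g (\<sigma> (w a))) a \<in> F (\<sigma> (w a))"
      using bij_betw_inv_into[OF g[of "\<sigma> (w a)"]] a \<sigma> by (metis bij_betwE)
    then show ?thesis using a g[of "w a"] by (auto simp: f_def dest: bij_betwE)
  qed
  have "f (f a) = a" if "a \<in> A" for a
  proof -
    have a: "a \<in> F (w a)" using that by (simp add: F_def)
    have wf: "w (f a) = \<sigma> (w a)" using f_in[OF that] by (simp add: F_def)
    consider "\<sigma> (w a) = w a" | "\<sigma> (w a) \<noteq> w a" "Q (w a)" "\<not> Q (\<sigma> (w a))"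
      | "\<sigma> (w a) \<noteq> w a" "\<not> Q (w a)" "Q (\<sigma> (w a))"
      using Q by metis
    then show ?thesis
    proof cases
      case 1
      then show ?thesis by (simp add: f_def)
    next
      case 2
      then have "f (f a) = inv_into (F (w a)) (g (w a)) (g (w a) a)"
        using wf \<sigma> unfolding f_def[of "f a"] by (simp add: f_def[of a])
      then show ?thesis using a g[of "w a"] by (simp add: bij_betw_inv_into_left)
    next
      case 3
      then have "f (f a) = g (\<sigma> (w a)) (inv_into (F (\<sigma> (w a))) (g (\<sigma> (w a))) a)"
        using wf \<sigma> unfolding f_def[of "f a"] by (simp add: f_def[of a])
      then show ?thesis using a g[of "\<sigma> (w a)"] \<sigma> by (simp add: bij_betw_inv_into_right)
    qed
  qed
  then show ?thesis
    using f_in unfolding involution_on_def F_def by (intro exI[of _ f]) auto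
qed

lemma count_sum_singletons:
  assumes "finite C"
  shows "count (\<Sum>b\<in>C. {#g b#}) t = card {b \<in> C. g b = t}"
proof -
  have "count (\<Sum>b\<in>C. {#g b#}) t = (\<Sum>b\<in>C. if g b = t then 1 else 0)"
    by (auto simp: count_sum intro!: sum.cong)
  also have "\<dots> = (\<Sum>b\<in>{b\<in>C. g b = t}. 1)"
    using assms by (intro sum.inter_filter[symmetric])
  finally show ?thesis by simp
qed

lemma decr_seqs_involution:
  assumes fin: "finite C" and lohi: "\<forall>b\<in>C. lo b < hi b"
    and anti: "\<forall>b\<in>C. \<forall>b'\<in>C. b < b' \<longrightarrow> lo b' \<le> lo b \<and> hi b' \<le> hi b"
  shows "\<exists>f. involution_on (decr_seqs C lo hi 0) f \<and> (\<forall>\<kappa> \<in> decr_seqs C lo hi 0.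
    card {b \<in> C. f \<kappa> b = lo b} = card {b \<in> C. \<kappa> b = hi b} \<and>
    card {b \<in> C. f \<kappa> b = hi b} = card {b \<in> C. \<kappa> b = lo b} \<and>
    (\<forall>k. card {b \<in> C. f \<kappa> b = k \<and> lo b < k \<and> k < hi b} =
      card {b \<in> C. \<kappa> b = k \<and> lo b < k \<and> k < hi b}))"
proof -
  let ?K = "decr_seqs C lo hi 0"
  define swap :: "(bool + nat) multiset \<Rightarrow> (bool + nat) multiset"
    where "swap = image_mset (map_sum Not id)"
  define w where "w = profile C lo hi True"
  have swap_profile: "swap (profile C lo hi s \<kappa>) = profile C lo hi (\<not> s) \<kappa>" for s \<kappa>
  proof -
    have "swap (\<Sum>b\<in>C. {#g b#}) = (\<Sum>b\<in>C. {#map_sum Not id (g b)#})" for g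
      using fin by induction (auto simp: swap_def id_def)
    then show ?thesis
      unfolding profile_def by (auto simp: end_weight_def intro!: sum.cong)
  qed
  have swap_swap: "swap (swap v) = v" for v
  proof -
    have "map_sum Not id \<circ> map_sum Not id = (id :: bool + nat \<Rightarrow> _)"
    proof
      fix r :: "bool + nat"
      show "(map_sum Not id \<circ> map_sum Not id) r = id r" by (cases r) simp_all
    qed
    then show ?thesis
      by (simp add: swap_def multiset.map_comp)
  qed
  have count_swap: "count (swap v) (Inl s) = count v (Inl (\<not> s))" "count (swap v) (Inr k) = count v (Inr k)"
    for v s k
  proof -
    show "count (swap v) (Inl s) = count v (Inl (\<not> s))"
    proof (induction v)
      case (add r v)
      then show ?case by (cases r) (auto simp: swap_def)
    qed (simp add: swap_def)
    show "count (swap v) (Inr k) = count v (Inr k)"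
    proof (induction v)
      case (add r v)
      then show ?case by (cases r) (auto simp: swap_def)
    qed (simp add: swap_def)
  qed
  \<comment> \<open>If \<open>swap\<close> moves \<open>v\<close>, the counts of the two
    \<open>Inl\<close> labels differ, as the other counts are unchanged; which one is larger then
    tells \<open>v\<close> from \<open>swap v\<close>.\<close>
  define Q where "Q v \<longleftrightarrow> count v (Inl True) < count v (Inl False)" for v :: "(bool + nat) multiset"
  have "Q (swap v) \<longleftrightarrow> \<not> Q v" if "swap v \<noteq> v" for v
  proof -
    have "count v (Inl True) \<noteq> count v (Inl False)"
    proof
      assume eq: "count v (Inl True) = count v (Inl False)"
      have "count (swap v) t = count v t" for t
      proof (cases t)
        case (Inl s)
        then show ?thesis using eq by (cases s) (simp_all add: count_swap)
      qed (simp add: count_swap)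
      then show False using that by (simp add: multiset_eq_iff)
    qed
    then show ?thesis by (auto simp: Q_def count_swap)
  qed
  moreover have "card {\<kappa> \<in> ?K. w \<kappa> = swap v} = card {\<kappa> \<in> ?K. w \<kappa> = v}" for v
  proof -
    \<comment> \<open>Exchanging labels turns this fibre of \<open>w\<close> into a fibre of the
      profile for \<open>False\<close>, which the comparison of coefficients covers.\<close>
    have "w \<kappa> = swap v \<longleftrightarrow> profile C lo hi False \<kappa> = v" for \<kappa>
      using swap_profile[of True \<kappa>] swap_swap unfolding w_def by metis
    then show ?thesis
      using card_profile_symmetric[OF assms, of v] by (simp add: w_def)
  qed
  ultimately obtain f where f: "involution_on ?K f" and wf: "\<And>\<kappa>. \<kappa> \<in> ?K \<Longrightarrow> w (f \<kappa>) = swap (w \<kappa>)"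
    using involution_if_card_symmetric[of ?K swap w Q] finite_decr_seqs[OF fin] swap_swap by blast
  have count_w: "count (w \<kappa>) (Inl True) = card {b \<in> C. \<kappa> b = hi b}"
    "count (w \<kappa>) (Inl False) = card {b \<in> C. \<kappa> b = lo b}"
    "count (w \<kappa>) (Inr k) = card {b \<in> C. \<kappa> b = k \<and> lo b < k \<and> k < hi b}" if "\<kappa> \<in> ?K" for \<kappa> k
  proof -
    have "lo b \<le> \<kappa> b \<and> \<kappa> b \<le> hi b \<and> lo b < hi b" if "b \<in> C" for b
      using \<open>\<kappa> \<in> ?K\<close> lohi that by (simp add: decr_seqs_def)
    then have "{b \<in> C. end_weight lo hi (Inl True) (Inl False) Inr b (\<kappa> b) = Inl True} = {b \<in> C. \<kappa> b = hi b}"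
      "{b \<in> C. end_weight lo hi (Inl True) (Inl False) Inr b (\<kappa> b) = Inl False} = {b \<in> C. \<kappa> b = lo b}"
      "{b \<in> C. end_weight lo hi (Inl True) (Inl False) Inr b (\<kappa> b) = Inr k} =
        {b \<in> C. \<kappa> b = k \<and> lo b < k \<and> k < hi b}"
      by (force simp: end_weight_def)+
    then show "count (w \<kappa>) (Inl True) = card {b \<in> C. \<kappa> b = hi b}"
      "count (w \<kappa>) (Inl False) = card {b \<in> C. \<kappa> b = lo b}"
      "count (w \<kappa>) (Inr k) = card {b \<in> C. \<kappa> b = k \<and> lo b < k \<and> k < hi b}"
      unfolding w_def profile_def by (simp_all add: count_sum_singletons[OF fin])
  qed
  show ?thesis
  proof (intro exI[of _ f] conjI ballI allI f)
    fix \<kappa> k assume \<kappa>: "\<kappa> \<in> ?K"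
    then have f\<kappa>: "f \<kappa> \<in> ?K" using f by (auto simp: involution_on_def)
    show "card {b \<in> C. f \<kappa> b = lo b} = card {b \<in> C. \<kappa> b = hi b}"
      "card {b \<in> C. f \<kappa> b = hi b} = card {b \<in> C. \<kappa> b = lo b}"
      "card {b \<in> C. f \<kappa> b = k \<and> lo b < k \<and> k < hi b} =
        card {b \<in> C. \<kappa> b = k \<and> lo b < k \<and> k < hi b}"
      unfolding count_w[OF f\<kappa>, symmetric] count_w[OF \<kappa>, symmetric] wf[OF \<kappa>] count_swap by simp_all
  qed
qed

subsection \<open>Order-convex diagrams\<close>

text \<open>Convexity for the product order on boxes. It holds for skew diagrams and also for the
  set of boxes that meet \<open>{i, i + 1}\<close>.\<close>

definition order_convex :: "(nat \<times> nat) set \<Rightarrow> bool" where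
  "order_convex D \<longleftrightarrow> (\<forall>a b a' b' a'' b''. (a, b) \<in> D \<longrightarrow> (a'', b'') \<in> D \<longrightarrow>
     a \<le> a' \<longrightarrow> a' \<le> a'' \<longrightarrow> b \<le> b' \<longrightarrow> b' \<le> b'' \<longrightarrow> (a', b') \<in> D)"

lemma order_convexD:
  assumes "order_convex D" "(a, b) \<in> D" "(a'', b'') \<in> D"
    and "a \<le> a'" "a' \<le> a''" "b \<le> b'" "b' \<le> b''"
  shows "(a', b') \<in> D"
  using assms unfolding order_convex_def by blast

lemma diagram_down_closed:
  assumes part: "is_partition lam" and mem: "(i, j) \<in> diagram lam"
    and "1 \<le> i'" "i' \<le> i" "1 \<le> j'" "j' \<le> j"
  shows "(i', j') \<in> diagram lam"
proof -
  have "lam ! (i - 1) \<le> lam ! (i' - 1)"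
  proof (cases "i' = i")
    case False
    then show ?thesis
      using part mem assms(3,4) unfolding is_partition_def diagram_def
      by (auto simp: sorted_wrt_iff_nth_less)
  qed simp
  then show ?thesis using mem assms(3-6) by (auto simp: diagram_def)
qed

lemma finite_diagram: "finite (diagram lam)"
proof (rule finite_subset)
  show "diagram lam \<subseteq> {..length lam} \<times> {..Max (set lam)}"
    by (auto simp: diagram_def intro!: order_trans[OF _ Max_ge])
qed simp

text \<open>Diagrams are closed under decreasing positive coordinates: the upper box puts a box in
  between into \<open>lam\<close>, and if that box were in \<open>mu\<close>, so would be the lower
  one.\<close>

lemma order_convex_skew_diagram:
  assumes "is_skew_shape lam mu"
  shows "order_convex (skew_diagram lam mu)"
  unfolding order_convex_def
proof (intro allI impI)
  fix a b a' b' a'' b''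
  assume m: "(a, b) \<in> skew_diagram lam mu" "(a'', b'') \<in> skew_diagram lam mu"
    and le: "a \<le> a'" "a' \<le> a''" "b \<le> b'" "b' \<le> b''"
  have pos: "1 \<le> a" "1 \<le> b" using m by (auto simp: skew_diagram_def diagram_def)
  have "(a', b') \<in> diagram lam"
    using diagram_down_closed[of lam a'' b'' a' b'] assms m le pos
    by (auto simp: is_skew_shape_def skew_diagram_def)
  moreover have "(a', b') \<notin> diagram mu"
    using diagram_down_closed[of mu a' b' a b] assms m le pos
    by (auto simp: is_skew_shape_def skew_diagram_def)
  ultimately show "(a', b') \<in> skew_diagram lam mu" by (simp add: skew_diagram_def)
qed

section \<open>Elementwise form of the order conditions\<close>

lemma set_le_iff:
  assumes "finite A" "A \<noteq> {}" "finite B" "B \<noteq> {}"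
  shows "set_le A B \<longleftrightarrow> (\<forall>x\<in>A. \<forall>y\<in>B. x \<le> y)"
  using assms by (auto simp: set_le_def)

text \<open>Turns the condition counted by \<open>ceq\<close> into the existence of a common element
  \<open>x\<close>, which is squeezed by \<open>Max A \<le> x \<le> Min B\<close> against the
  inequalities given by membership.\<close>

lemma Max_eq_Min_iff:
  fixes A B :: "nat set"
  assumes "finite A" "A \<noteq> {}" "finite B" "B \<noteq> {}" "\<forall>x\<in>A. \<forall>y\<in>B. x \<le> y"
  shows "Max A = Min B \<longleftrightarrow> A \<inter> B \<noteq> {}"
proof
  assume "Max A = Min B"
  then show "A \<inter> B \<noteq> {}" using assms(1-4) by (metis Max_in Min_in disjoint_iff)
next
  assume "A \<inter> B \<noteq> {}"
  then obtain x where x: "x \<in> A" "x \<in> B" by blast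
  have "Max A \<le> x" using assms x by simp
  moreover have "x \<le> Min B" using assms x by simp
  moreover have "x \<le> Max A" "Min B \<le> x" using assms x by simp_all
  ultimately show "Max A = Min B" by simp
qed

lemma SVRPP_iff:
  "T \<in> SVRPP D \<longleftrightarrow> T \<in> extensional D \<and>
     (\<forall>c\<in>D. finite (T c) \<and> T c \<noteq> {} \<and> (\<forall>k\<in>T c. 1 \<le> k)) \<and>
     (\<forall>a b b'. (a, b) \<in> D \<longrightarrow> (a, b') \<in> D \<longrightarrow> b < b' \<longrightarrow> (\<forall>x\<in>T (a, b). \<forall>y\<in>T (a, b'). x \<le> y)) \<and>
     (\<forall>a a' b. (a, b) \<in> D \<longrightarrow> (a', b) \<in> D \<longrightarrow> a < a' \<longrightarrow> (\<forall>x\<in>T (a, b). \<forall>y\<in>T (a', b). x \<le> y))"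
proof -
  have "set_le (T c) (T c') \<longleftrightarrow> (\<forall>x\<in>T c. \<forall>y\<in>T c'. x \<le> y)"
    if "\<forall>c\<in>D. finite (T c) \<and> T c \<noteq> {}" "c \<in> D" "c' \<in> D" for c c'
    using that by (intro set_le_iff) auto
  then show ?thesis
    unfolding SVRPP_def by (auto simp: PiE_iff)
qed

lemma SVRPPD:
  assumes "T \<in> SVRPP D"
  shows "T \<in> extensional D" "c \<in> D \<Longrightarrow> finite (T c)" "c \<in> D \<Longrightarrow> T c \<noteq> {}"
    "c \<in> D \<Longrightarrow> \<forall>k\<in>T c. 1 \<le> k"
proof -
  note T = iffD1[OF SVRPP_iff assms]
  show "T \<in> extensional D" using T by (rule conjunct1)
  have "\<forall>c\<in>D. finite (T c) \<and> T c \<noteq> {} \<and> (\<forall>k\<in>T c. 1 \<le> k)" using T by (elim conjE)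
  then show "c \<in> D \<Longrightarrow> finite (T c)" "c \<in> D \<Longrightarrow> T c \<noteq> {}" "c \<in> D \<Longrightarrow> \<forall>k\<in>T c. 1 \<le> k"
    by simp_all
qed

text \<open>Column and row conditions are chained at the corner box \<open>(a', b)\<close>, which
  lies in \<open>D\<close> by convexity; any element of its nonempty set lies between
  \<open>x\<close> and \<open>y\<close>.\<close>

lemma SVRPP_le:
  assumes T: "T \<in> SVRPP D" and D: "order_convex D"
    and mem: "(a, b) \<in> D" "(a', b') \<in> D"
    and le: "a \<le> a'" "b \<le> b'" "(a, b) \<noteq> (a', b')"
    and xy: "x \<in> T (a, b)" "y \<in> T (a', b')"
  shows "x \<le> y"
proof -
  have row: "u \<le> v" if "(p, q) \<in> D" "(p, q') \<in> D" "q < q'" "u \<in> T (p, q)" "v \<in> T (p, q')" for p q q' u v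
    using T that unfolding SVRPP_iff by blast
  have col: "u \<le> v" if "(p, q) \<in> D" "(p', q) \<in> D" "p < p'" "u \<in> T (p, q)" "v \<in> T (p', q)" for p p' q u v
    using T that unfolding SVRPP_iff by blast
  have corner: "(a', b) \<in> D" by (rule order_convexD[OF D mem]) (use le in auto)
  then obtain w where w: "w \<in> T (a', b)" using SVRPPD(3)[OF T corner] by blast
  consider "a = a'" "b < b'" | "a < a'" "b = b'" | "a < a'" "b < b'" using le by fastforce
  then show ?thesis
  proof cases
    case 3
    then show ?thesis using col[OF mem(1) corner _ xy(1) w] row[OF corner mem(2) _ w xy(2)] by simp
  qed (use row col mem xy in blast)+
qed

subsection \<open>Fillings that differ only in the entries i and i + 1\<close>

text \<open>\<open>T0\<close> represents its class: the fillings that agree with it off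
  \<open>{i, i + 1}\<close> and meet \<open>{i, i + 1}\<close> in the same boxes.\<close>

locale bender_knuth_class =
  fixes D :: "(nat \<times> nat) set" and T0 :: "nat \<times> nat \<Rightarrow> nat set" and i :: nat
  assumes finD: "finite D" and convD: "order_convex D" and T0: "T0 \<in> SVRPP D" and i: "1 \<le> i"
begin

definition support :: "(nat \<times> nat) set" where
  "support = {c \<in> D. T0 c \<inter> {i, i + 1} \<noteq> {}}"

definition rest :: "nat \<times> nat \<Rightarrow> nat set" where
  "rest c = T0 c - {i, i + 1}"

definition cols :: "nat set" where "cols = snd ` support"
definition top_row :: "nat \<Rightarrow> nat" where "top_row b = Min {a. (a, b) \<in> support}"
definition bottom_row :: "nat \<Rightarrow> nat" where "bottom_row b = Max {a. (a, b) \<in> support}"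
definition lo :: "nat \<Rightarrow> nat" where "lo b = 2 * top_row b"
definition hi :: "nat \<Rightarrow> nat" where "hi b = 2 * bottom_row b + 2"

section \<open>Geometry of the support\<close>

lemma finite_support: "finite support"
  using finD by (simp add: support_def)

lemma finite_cols: "finite cols"
  using finite_support by (simp add: cols_def)

lemma support_subset: "support \<subseteq> D"
  by (auto simp: support_def)

text \<open>An entry of a box in between is squeezed between an entry that is at least
  \<open>i\<close> and one that is at most \<open>i + 1\<close>.\<close>

lemma support_convex: "order_convex support"
  unfolding order_convex_def
proof (intro allI impI)
  fix a b a' b' a'' b''
  assume m: "(a, b) \<in> support" "(a'', b'') \<in> support"
    and le: "a \<le> a'" "a' \<le> a''" "b \<le> b'" "b' \<le> b''"
  have D: "(a, b) \<in> D" "(a'', b'') \<in> D" using m by (auto simp: support_def)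
  have D': "(a', b') \<in> D" by (rule order_convexD[OF convD D le])
  show "(a', b') \<in> support"
  \<comment> \<open>The end boxes are set aside because \<open>SVRPP_le\<close> compares distinct
    boxes only.\<close>
  proof (cases "(a', b') = (a, b) \<or> (a', b') = (a'', b'')")
    case True
    then show ?thesis using m by auto
  next
    case False
    obtain u v where u: "u \<in> T0 (a, b)" "i \<le> u" and v: "v \<in> T0 (a'', b'')" "v \<le> i + 1"
      using m by (auto simp: support_def)
    obtain w where w: "w \<in> T0 (a', b')" using SVRPPD(3)[OF T0 D'] by blast
    have "u \<le> w" using SVRPP_le[OF T0 convD D(1) D' _ _ _ u(1) w] le False by auto
    moreover have "w \<le> v" using SVRPP_le[OF T0 convD D' D(2) _ _ _ w v(1)] le False by auto
    ultimately have "w = i \<or> w = i + 1" using u v by linarith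
    then show ?thesis using D' w by (auto simp: support_def)
  qed
qed

lemma support_iff: "(a, b) \<in> support \<longleftrightarrow> b \<in> cols \<and> top_row b \<le> a \<and> a \<le> bottom_row b"
proof -
  let ?R = "{a. (a, b) \<in> support}"
  have "?R \<subseteq> fst ` support" by force
  then have fin: "finite ?R" using finite_support by (meson finite_imageI finite_subset)
  show ?thesis
  proof
    assume "(a, b) \<in> support"
    then show "b \<in> cols \<and> top_row b \<le> a \<and> a \<le> bottom_row b"
      using fin by (force simp: cols_def top_row_def bottom_row_def)
  next
    assume a: "b \<in> cols \<and> top_row b \<le> a \<and> a \<le> bottom_row b"
    then have "?R \<noteq> {}" by (auto simp: cols_def)
    then have "top_row b \<in> ?R" "bottom_row b \<in> ?R"
      unfolding top_row_def bottom_row_def using fin Min_in Max_in by blast+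
    then show "(a, b) \<in> support"
      using order_convexD[OF support_convex, of "top_row b" b "bottom_row b" b a b] a by simp
  qed
qed

lemma top_le_bottom: "b \<in> cols \<Longrightarrow> top_row b \<le> bottom_row b"
  unfolding cols_def using support_iff by force

text \<open>If the top row went down from \<open>b\<close> to \<open>b'\<close>, convexity would put
  \<open>(top_row b, b')\<close> into the support, above the top of column \<open>b'\<close>;
  likewise for the bottom rows.\<close>

lemma corner_rows_antitone:
  assumes "b \<in> cols" "b' \<in> cols" "b < b'"
  shows "top_row b' \<le> top_row b" "bottom_row b' \<le> bottom_row b"
proof -
  have m: "(top_row b, b) \<in> support" "(bottom_row b, b) \<in> support"
    "(top_row b', b') \<in> support" "(bottom_row b', b') \<in> support"
    using assms top_le_bottom by (auto simp: support_iff)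
  show "top_row b' \<le> top_row b"
  proof (rule ccontr)
    assume neg: "\<not> ?thesis"
    then have "(top_row b, b') \<in> support"
      using order_convexD[OF support_convex m(1,3)] assms neg by simp
    then show False using neg by (simp add: support_iff)
  qed
  show "bottom_row b' \<le> bottom_row b"
  proof (rule ccontr)
    assume neg: "\<not> ?thesis"
    then have "(bottom_row b', b) \<in> support"
      using order_convexD[OF support_convex m(2,4)] assms neg by simp
    then show False using neg by (simp add: support_iff)
  qed
qed

text \<open>With its mirror image below, this shows that the other entries compare strictly with
  both \<open>i\<close> and \<open>i + 1\<close>, so redistributing these two cannot disturb
  them.\<close>

lemma rest_le_support:
  assumes T: "T \<in> SVRPP D" and c: "(a, b) \<in> D" "(a', b') \<in> D" "a \<le> a'" "b \<le> b'" "(a, b) \<noteq> (a', b')"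
    and x: "x \<in> T (a, b)" "x \<noteq> i" "x \<noteq> i + 1" and s: "T (a', b') \<inter> {i, i + 1} \<noteq> {}"
  shows "x < i"
proof -
  obtain y where "y \<in> T (a', b')" "y \<le> i + 1" using s by auto
  then have "x \<le> i + 1" using SVRPP_le[OF T convD c x(1)] by fastforce
  then show ?thesis using x by linarith
qed

lemma support_le_rest:
  assumes T: "T \<in> SVRPP D" and c: "(a, b) \<in> D" "(a', b') \<in> D" "a \<le> a'" "b \<le> b'" "(a, b) \<noteq> (a', b')"
    and s: "T (a, b) \<inter> {i, i + 1} \<noteq> {}" and y: "y \<in> T (a', b')" "y \<noteq> i" "y \<noteq> i + 1"
  shows "i + 1 < y"
proof -
  obtain x where "x \<in> T (a, b)" "i \<le> x" using s by auto
  then have "i \<le> y" using SVRPP_le[OF T convD c _ y(1)] by fastforce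
  then show ?thesis using y by linarith
qed

section \<open>Encoding of a class by keys\<close>

definition same_class :: "(nat \<times> nat \<Rightarrow> nat set) set" where
  "same_class = {T \<in> SVRPP D. \<forall>c\<in>D. T c - {i, i + 1} = T0 c - {i, i + 1} \<and>
     (T c \<inter> {i, i + 1} = {} \<longleftrightarrow> T0 c \<inter> {i, i + 1} = {})}"

definition entries :: "(nat \<Rightarrow> nat) \<Rightarrow> nat \<times> nat \<Rightarrow> nat set" where
  "entries \<kappa> c = {j. j = i \<and> 2 * fst c + 1 \<le> \<kappa> (snd c) \<or> j = i + 1 \<and> \<kappa> (snd c) \<le> 2 * fst c + 1}"

definition filling :: "(nat \<Rightarrow> nat) \<Rightarrow> nat \<times> nat \<Rightarrow> nat set" where
  "filling \<kappa> = (\<lambda>c\<in>D. rest c \<union> (if c \<in> support then entries \<kappa> c else {}))"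

text \<open>Two columns with the same odd key \<open>2 * a + 1\<close> would both contain
  \<open>i\<close> and \<open>i + 1\<close> in row \<open>a\<close>, against the row condition;
  equal even keys cause no conflict.\<close>

definition keys :: "(nat \<Rightarrow> nat) set" where
  "keys = {\<kappa> \<in> decr_seqs cols lo hi 0.
     \<forall>b\<in>cols. \<forall>b'\<in>cols. b < b' \<longrightarrow> \<kappa> b = \<kappa> b' \<longrightarrow> even (\<kappa> b)}"

lemma entries_props:
  "entries \<kappa> c \<noteq> {}" "entries \<kappa> c \<subseteq> {i, i + 1}" "finite (entries \<kappa> c)"
proof -
  show s: "entries \<kappa> c \<subseteq> {i, i + 1}" by (auto simp: entries_def)
  show "finite (entries \<kappa> c)" by (rule finite_subset[OF s]) simp
  show "entries \<kappa> c \<noteq> {}"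
    using linear[of "2 * fst c + 1" "\<kappa> (snd c)"] by (auto simp: entries_def)
qed

lemma keysD:
  assumes "\<kappa> \<in> keys" "b \<in> cols"
  shows "lo b \<le> \<kappa> b" "\<kappa> b \<le> hi b"
  using assms by (auto simp: keys_def decr_seqs_def)

lemma filling_off_pair: "c \<in> D \<Longrightarrow> filling \<kappa> c - {i, i + 1} = rest c"
  using entries_props(2)[of \<kappa> c] by (auto simp: filling_def rest_def)

lemma filling_on_pair:
  "c \<in> D \<Longrightarrow> filling \<kappa> c \<inter> {i, i + 1} = (if c \<in> support then entries \<kappa> c else {})"
  using entries_props(2)[of \<kappa> c] by (auto simp: filling_def rest_def)

text \<open>Comparisons with an entry of \<open>rest\<close> are inherited from \<open>T0\<close>;
  the key matters only when both entries come from \<open>{i, i + 1}\<close>.\<close>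

lemma filling_le:
  assumes k: "\<kappa> \<in> keys" and c: "(a, b) \<in> D" "(a', b') \<in> D"
    and rc: "a = a' \<and> b < b' \<or> a < a' \<and> b = b'"
    and x: "x \<in> filling \<kappa> (a, b)" and y: "y \<in> filling \<kappa> (a', b')"
  shows "x \<le> y"
proof -
  have le: "a \<le> a'" "b \<le> b'" "(a, b) \<noteq> (a', b')" using rc by auto
  have x': "x \<in> rest (a, b) \<or> (a, b) \<in> support \<and> x \<in> entries \<kappa> (a, b)"
    and y': "y \<in> rest (a', b') \<or> (a', b') \<in> support \<and> y \<in> entries \<kappa> (a', b')"
    using x y c by (auto simp: filling_def split: if_splits)
  consider "x \<in> rest (a, b)" "y \<in> rest (a', b')"
    | "x \<in> rest (a, b)" "(a', b') \<in> support" "y \<in> entries \<kappa> (a', b')"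
    | "(a, b) \<in> support" "x \<in> entries \<kappa> (a, b)" "y \<in> rest (a', b')"
    | "(a, b) \<in> support" "x \<in> entries \<kappa> (a, b)" "(a', b') \<in> support" "y \<in> entries \<kappa> (a', b')"
    using x' y' by blast
  then show ?thesis
  proof cases
    case 1
    then show ?thesis using SVRPP_le[OF T0 convD c le] by (auto simp: rest_def)
  next
    case 2
    then have "x < i" using rest_le_support[OF T0 c le] by (auto simp: rest_def support_def)
    then show ?thesis using 2 entries_props(2) by fastforce
  next
    case 3
    then have "i + 1 < y" using support_le_rest[OF T0 c le] by (auto simp: rest_def support_def)
    then show ?thesis using 3 entries_props(2)[of \<kappa> "(a, b)"] by auto
  next
    case 4
    show ?thesis
    proof (rule ccontr)
      assume "\<not> x \<le> y"
      then have "x = i + 1" "y = i" using 4 by (auto simp: entries_def)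
      then have kk: "\<kappa> b \<le> 2 * a + 1" "2 * a' + 1 \<le> \<kappa> b'" using 4 by (auto simp: entries_def)
      \<comment> \<open>Within one column the two bounds on the key contradict each other. Within a
        row, monotonicity forces the keys to be equal and odd.\<close>
      then have row: "a = a'" "b < b'" using rc by auto
      have cols: "b \<in> cols" "b' \<in> cols" using 4 by (auto simp: support_iff)
      then have "\<kappa> b' \<le> \<kappa> b" using k row by (auto simp: keys_def decr_seqs_def)
      then have "\<kappa> b = 2 * a + 1" "\<kappa> b' = \<kappa> b" using kk row by auto
      moreover have "even (\<kappa> b)" if "\<kappa> b = \<kappa> b'"
        using k cols row that unfolding keys_def by blast
      ultimately show False by simp
    qed
  qed
qed

lemma filling_in_class:
  assumes k: "\<kappa> \<in> keys"
  shows "filling \<kappa> \<in> same_class"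
proof -
  have "finite (filling \<kappa> c) \<and> filling \<kappa> c \<noteq> {} \<and> (\<forall>k\<in>filling \<kappa> c. 1 \<le> k)" if c: "c \<in> D" for c
  proof -
    have t: "finite (T0 c)" "T0 c \<noteq> {}" "\<forall>k\<in>T0 c. 1 \<le> k" using SVRPPD[OF T0] c by auto
    show ?thesis
    proof (cases "c \<in> support")
      case True
      then have "filling \<kappa> c = rest c \<union> entries \<kappa> c" using c by (simp add: filling_def)
      then show ?thesis using t entries_props[of \<kappa> c] i by (auto simp: rest_def)
    next
      case False
      then have "filling \<kappa> c = T0 c" using c by (auto simp: filling_def rest_def support_def)
      then show ?thesis using t by simp
    qed
  qed
  then have "filling \<kappa> \<in> SVRPP D"
    unfolding SVRPP_iff using filling_le[OF k] by (auto simp: filling_def)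
  moreover have "filling \<kappa> c - {i, i + 1} = T0 c - {i, i + 1}" if "c \<in> D" for c
    using filling_off_pair[OF that] by (simp only: rest_def)
  moreover have "filling \<kappa> c \<inter> {i, i + 1} = {} \<longleftrightarrow> T0 c \<inter> {i, i + 1} = {}" if "c \<in> D" for c
    unfolding filling_on_pair[OF that] using that entries_props(1) by (simp add: support_def)
  ultimately show ?thesis by (simp only: same_class_def mem_Collect_eq) blast
qed

text \<open>If \<open>i\<close> is absent from the column, the key is \<open>lo b\<close>. Otherwise
  let \<open>q\<close> be the last row that contains \<open>i\<close>: the key is
  \<open>2 * q + 1\<close> if that row also contains \<open>i + 1\<close>, and
  \<open>2 * q + 2\<close> if not.\<close>

lemma ex_column_key:
  assumes T: "T \<in> same_class" and b: "b \<in> cols"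
  shows "\<exists>k. lo b \<le> k \<and> k \<le> hi b \<and> (\<forall>a. (a, b) \<in> support \<longrightarrow>
    (i \<in> T (a, b) \<longleftrightarrow> 2 * a + 1 \<le> k) \<and> (i + 1 \<in> T (a, b) \<longleftrightarrow> k \<le> 2 * a + 1))"
proof -
  have TS: "T \<in> SVRPP D" using T by (simp add: same_class_def)
  have meets: "i \<in> T (a, b) \<or> i + 1 \<in> T (a, b)" if "(a, b) \<in> support" for a
    using T that unfolding same_class_def support_def by blast
  have col: "x \<le> y" if "(a, b) \<in> support" "(a', b) \<in> support" "a < a'" "x \<in> T (a, b)" "y \<in> T (a', b)"
    for a a' x y
    using SVRPP_le[OF TS convD, of a b a' b x y] that support_subset by auto
  define I where "I = {a. (a, b) \<in> support \<and> i \<in> T (a, b)}"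
  have finI: "finite I"
    by (rule finite_subset[of _ "{..bottom_row b}"]) (auto simp: I_def support_iff)
  show ?thesis
  proof (cases "I = {}")
    case True
    then show ?thesis
      using meets top_le_bottom[OF b]
      by (intro exI[of _ "lo b"]) (auto simp: I_def lo_def hi_def support_iff)
  next
    case False
    define q where "q = Max I"
    have q: "(q, b) \<in> support" "i \<in> T (q, b)" and qmax: "\<And>a. (a, b) \<in> support \<Longrightarrow> i \<in> T (a, b) \<Longrightarrow> a \<le> q"
      using Max_in[OF finI False] Max_ge[OF finI] by (auto simp: q_def I_def)
    have iT: "i \<in> T (a, b) \<longleftrightarrow> a \<le> q" if "(a, b) \<in> support" for a
      using qmax[OF that] meets[OF that] col[OF that q(1) _ _ q(2), of "i + 1"] q(2)
      by (cases "a = q") auto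
    have sT: "i + 1 \<in> T (a, b) \<longleftrightarrow> q < a \<or> q = a \<and> i + 1 \<in> T (q, b)" if "(a, b) \<in> support" for a
      using meets[OF that] iT[OF that] col[OF that q(1) _ _ q(2), of "i + 1"]
      by (cases a q rule: linorder_cases) auto
    have bounds: "top_row b \<le> q" "q \<le> bottom_row b" using q by (auto simp: support_iff)
    show ?thesis
    proof (cases "i + 1 \<in> T (q, b)")
      case True
      then show ?thesis
        using iT sT bounds by (intro exI[of _ "2 * q + 1"]) (auto simp: lo_def hi_def)
    next
      case False
      then show ?thesis
        using iT sT bounds by (intro exI[of _ "2 * q + 2"]) (auto simp: lo_def hi_def)
    qed
  qed
qed

lemma ex_key:
  assumes T: "T \<in> same_class"
  shows "\<exists>\<kappa>\<in>keys. filling \<kappa> = T"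
proof -
  have TS: "T \<in> SVRPP D" using T by (simp add: same_class_def)
  obtain k where k: "\<And>b. b \<in> cols \<Longrightarrow> lo b \<le> k b" "\<And>b. b \<in> cols \<Longrightarrow> k b \<le> hi b"
    and ki: "\<And>a b. (a, b) \<in> support \<Longrightarrow> i \<in> T (a, b) \<longleftrightarrow> 2 * a + 1 \<le> k b"
    and ks: "\<And>a b. (a, b) \<in> support \<Longrightarrow> i + 1 \<in> T (a, b) \<longleftrightarrow> k b \<le> 2 * a + 1"
    using ex_column_key[OF T] support_iff by metis
  define \<kappa> where "\<kappa> = restrict k cols"
  have ordered: "k b' \<le> k b \<and> (k b = k b' \<longrightarrow> even (k b))" if b: "b \<in> cols" "b' \<in> cols" "b < b'" for b b'
  proof (rule ccontr)
    assume neg: "\<not> ?thesis"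
    \<comment> \<open>In row \<open>a\<close> the larger entry in column \<open>b\<close> would precede the smaller one in column \<open>b'\<close>.\<close>
    define a where "a = k b div 2"
    have kk: "k b \<le> 2 * a + 1" "2 * a + 1 \<le> k b'"
      using neg unfolding a_def by presburger+
    have "top_row b \<le> a" using k(1)[OF b(1)] by (simp add: a_def lo_def)
    moreover have "a \<le> bottom_row b'" using k(2)[OF b(2)] kk(2) by (simp add: hi_def)
    ultimately have s: "(a, b) \<in> support" "(a, b') \<in> support"
      using b corner_rows_antitone[OF b] by (auto simp: support_iff)
    then have "i + 1 \<le> i"
      using SVRPP_le[OF TS convD, of a b a b' "i + 1" i] ki[OF s(2)] ks[OF s(1)] kk b support_subset
      by auto
    then show False by simp
  qed
  have "\<kappa> \<in> keys"
    using k ordered unfolding keys_def decr_seqs_def \<kappa>_def by auto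
  moreover have "filling \<kappa> = T"
  proof
    fix c
    show "filling \<kappa> c = T c"
    proof (cases "c \<in> D")
      case True
      obtain a b where ab: "c = (a, b)" by (cases c)
      have "filling \<kappa> c \<inter> {i, i + 1} = T c \<inter> {i, i + 1}"
      proof (cases "c \<in> support")
        case s: True
        then have "\<kappa> b = k b" using ab by (simp add: \<kappa>_def support_iff)
        then show ?thesis
          using filling_on_pair[OF True, of \<kappa>] s ki[of a b] ks[of a b] unfolding ab
          by (auto simp: entries_def)
      next
        case False
        then show ?thesis
          using filling_on_pair[OF True, of \<kappa>] T True by (auto simp: same_class_def support_def)
      qed
      moreover have "filling \<kappa> c - {i, i + 1} = T c - {i, i + 1}"
        using filling_off_pair[OF True, of \<kappa>] T True by (auto simp: same_class_def rest_def)
      ultimately show ?thesis by blast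
    next
      case False
      then show ?thesis using extensional_arb[OF SVRPPD(1)[OF TS]] by (simp add: filling_def)
    qed
  qed
  ultimately show ?thesis by blast
qed

text \<open>If the keys differ in column \<open>b\<close>, half the smaller one, rounded down, is a
  row of the support where the entries differ: in \<open>i\<close> if the smaller key is even, in
  \<open>i + 1\<close> if it is odd.\<close>

lemma inj_filling: "inj_on filling keys"
proof (rule inj_onI)
  have key_le: "\<kappa>' b \<le> \<kappa> b" if "\<kappa> \<in> keys" "\<kappa>' \<in> keys" "filling \<kappa> = filling \<kappa>'" "b \<in> cols" for \<kappa> \<kappa>' b
  proof (rule ccontr)
    assume less: "\<not> ?thesis"
    define a where "a = \<kappa> b div 2"
    have a: "\<kappa> b = 2 * a \<or> \<kappa> b = 2 * a + 1" unfolding a_def by presburger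
    have "(a, b) \<in> support"
      using a less keysD[OF that(1,4)] keysD[OF that(2,4)] that(4)
      by (auto simp: support_iff lo_def hi_def)
    then have "entries \<kappa> (a, b) = entries \<kappa>' (a, b)"
      using filling_on_pair[of "(a, b)"] that(3) support_subset by (metis subsetD)
    then have "i \<in> entries \<kappa> (a, b) \<longleftrightarrow> i \<in> entries \<kappa>' (a, b)"
      "i + 1 \<in> entries \<kappa> (a, b) \<longleftrightarrow> i + 1 \<in> entries \<kappa>' (a, b)" by simp_all
    then show False using a less by (auto simp: entries_def)
  qed
  fix \<kappa> \<kappa>' assume k: "\<kappa> \<in> keys" "\<kappa>' \<in> keys" "filling \<kappa> = filling \<kappa>'"
  have "\<kappa> \<in> extensional cols" "\<kappa>' \<in> extensional cols"
    using k by (auto simp: keys_def decr_seqs_def PiE_iff)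
  then show "\<kappa> = \<kappa>'"
    by (rule extensionalityI) (use key_le k in \<open>metis order_antisym\<close>)
qed

lemma bij_filling: "bij_betw filling keys same_class"
  unfolding bij_betw_def using inj_filling filling_in_class ex_key by blast

section \<open>The statistics of a filling in terms of its key\<close>

lemma filling_SVRPP: "\<kappa> \<in> keys \<Longrightarrow> filling \<kappa> \<in> SVRPP D"
  using filling_in_class by (auto simp: same_class_def)

lemma on_filling:
  assumes "c \<in> D"
  shows "j \<in> filling \<kappa> c \<longleftrightarrow> (if j = i \<or> j = i + 1 then c \<in> support \<and> j \<in> entries \<kappa> c else j \<in> rest c)"
  using assms by (auto simp: filling_def rest_def entries_def)

text \<open>The sets are disjoint exactly when the switch falls between the two rows. An entry of
  \<open>rest\<close> in both boxes would be less than \<open>i\<close> and greater than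
  \<open>i + 1\<close>.\<close>

lemma adjacent_filling_meet:
  assumes k: "\<kappa> \<in> keys" and c: "(a, b) \<in> support" "(a + 1, b) \<in> support"
  shows "filling \<kappa> (a, b) \<inter> filling \<kappa> (a + 1, b) \<noteq> {} \<longleftrightarrow> \<kappa> b \<noteq> 2 * a + 2"
proof -
  have D: "(a, b) \<in> D" "(a + 1, b) \<in> D" using c support_subset by auto
  have off: "rest (a, b) \<inter> rest (a + 1, b) = {}"
  proof (rule ccontr)
    assume "\<not> ?thesis"
    then obtain x where x: "x \<in> rest (a, b)" "x \<in> rest (a + 1, b)" by blast
    have "x < i"
      using rest_le_support[OF T0 D, of x] x c by (auto simp: rest_def support_def)
    moreover have "i + 1 < x"
      using support_le_rest[OF T0 D, of x] x c by (auto simp: rest_def support_def)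
    ultimately show False by simp
  qed
  have "filling \<kappa> (a, b) \<inter> filling \<kappa> (a + 1, b) \<noteq> {} \<longleftrightarrow>
      (i \<in> filling \<kappa> (a, b) \<and> i \<in> filling \<kappa> (a + 1, b)) \<or>
      (i + 1 \<in> filling \<kappa> (a, b) \<and> i + 1 \<in> filling \<kappa> (a + 1, b))"
    using off on_filling[OF D(1), of _ \<kappa>] on_filling[OF D(2), of _ \<kappa>] by (auto split: if_splits)
  also have "\<dots> \<longleftrightarrow> 2 * a + 3 \<le> \<kappa> b \<or> \<kappa> b \<le> 2 * a + 1"
    using on_filling[OF D(1), of _ \<kappa>] on_filling[OF D(2), of _ \<kappa>] c
    by (auto simp: entries_def)
  finally show ?thesis by auto
qed

lemma not_adjacent_filling_meet:
  assumes D: "(a, b) \<in> D" "(a + 1, b) \<in> D" and c: "\<not> ((a, b) \<in> support \<and> (a + 1, b) \<in> support)"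
  shows "filling \<kappa> (a, b) \<inter> filling \<kappa> (a + 1, b) = rest (a, b) \<inter> rest (a + 1, b)"
proof (rule set_eqI)
  fix j
  show "j \<in> filling \<kappa> (a, b) \<inter> filling \<kappa> (a + 1, b) \<longleftrightarrow> j \<in> rest (a, b) \<inter> rest (a + 1, b)"
    using c unfolding Int_iff on_filling[OF D(1)] on_filling[OF D(2)]
    by (auto simp: rest_def)
qed

text \<open>Only the last cardinality depends on the key. For a column of \<open>cols\<close>, the
  bounds on \<open>2 * a + 2\<close> say that both rows lie in the support, so the subtracted set is
  a subset and the truncated difference is exact.\<close>

lemma ceq_filling:
  assumes k: "\<kappa> \<in> keys"
  shows "ceq D (filling \<kappa>) a =
    card {b. (a, b) \<in> D \<and> (a + 1, b) \<in> D \<and> \<not> ((a, b) \<in> support \<and> (a + 1, b) \<in> support) \<and>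
      rest (a, b) \<inter> rest (a + 1, b) \<noteq> {}} +
    (card {b. (a, b) \<in> support \<and> (a + 1, b) \<in> support} -
      card {b \<in> cols. \<kappa> b = 2 * a + 2 \<and> lo b < 2 * a + 2 \<and> 2 * a + 2 < hi b})"
proof -
  let ?X = "{b. (a, b) \<in> D \<and> (a + 1, b) \<in> D \<and> \<not> ((a, b) \<in> support \<and> (a + 1, b) \<in> support) \<and>
      rest (a, b) \<inter> rest (a + 1, b) \<noteq> {}}"
  let ?Y = "{b. (a, b) \<in> support \<and> (a + 1, b) \<in> support}"
  let ?Z = "{b \<in> cols. \<kappa> b = 2 * a + 2 \<and> lo b < 2 * a + 2 \<and> 2 * a + 2 < hi b}"
  have "?X \<subseteq> snd ` D" by force
  then have finX: "finite ?X" using finD by (meson finite_imageI finite_subset)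
  have "?Y \<subseteq> cols" by (auto simp: support_iff)
  then have finY: "finite ?Y" using finite_cols by (rule finite_subset)
  have "?Z \<subseteq> ?Y" by (auto simp: support_iff lo_def hi_def)
  have T: "filling \<kappa> \<in> SVRPP D" using k by (rule filling_SVRPP)
  have "Max (filling \<kappa> (a, b)) = Min (filling \<kappa> (a + 1, b)) \<longleftrightarrow>
      filling \<kappa> (a, b) \<inter> filling \<kappa> (a + 1, b) \<noteq> {}" if D: "(a, b) \<in> D" "(a + 1, b) \<in> D" for b
    using SVRPP_le[OF T convD D] SVRPPD(2,3)[OF T D(1)] SVRPPD(2,3)[OF T D(2)]
    by (intro Max_eq_Min_iff) auto
  moreover have "filling \<kappa> (a, b) \<inter> filling \<kappa> (a + 1, b) \<noteq> {} \<longleftrightarrow> b \<notin> ?Z" if "b \<in> ?Y" for b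
  proof -
    have "\<kappa> b \<noteq> 2 * a + 2 \<longleftrightarrow> b \<notin> ?Z" using that by (auto simp: support_iff lo_def hi_def)
    then show ?thesis using adjacent_filling_meet[OF k, of a b] that by simp
  qed
  ultimately have "(a, b) \<in> D \<and> (a + 1, b) \<in> D \<and> Max (filling \<kappa> (a, b)) = Min (filling \<kappa> (a + 1, b)) \<longleftrightarrow>
      b \<in> ?X \<union> (?Y - ?Z)" for b
    using not_adjacent_filling_meet[of a b \<kappa>] subsetD[OF support_subset, of "(a, b)"]
      subsetD[OF support_subset, of "(a + 1, b)"]
    by (cases "b \<in> ?Y"; cases "(a, b) \<in> D \<and> (a + 1, b) \<in> D") auto
  then have "{b. (a, b) \<in> D \<and> (a + 1, b) \<in> D \<and> Max (filling \<kappa> (a, b)) = Min (filling \<kappa> (a + 1, b))} =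
      ?X \<union> (?Y - ?Z)"
    by (simp only: Collect_mem_eq)
  moreover have "?X \<inter> (?Y - ?Z) = {}" by blast
  moreover have "card (?Y - ?Z) = card ?Y - card ?Z"
    using \<open>?Z \<subseteq> ?Y\<close> finY by (intro card_Diff_subset) (auto intro: finite_subset)
  ultimately show ?thesis
    using finX finY by (simp only: ceq_def card_Un_disjoint[OF finX finite_Diff[OF finY]])
qed

text \<open>A box of the support has one entry from \<open>{i, i + 1}\<close>, which cancels the
  \<open>- 1\<close>, and a second one exactly when the key is \<open>2 * a + 1\<close>.\<close>

lemma card_filling:
  assumes c: "(a, b) \<in> D"
  shows "card (filling \<kappa> (a, b)) - 1 =
    (if (a, b) \<in> support then card (rest (a, b)) else card (rest (a, b)) - 1) +
    (if (a, b) \<in> support \<and> \<kappa> b = 2 * a + 1 then 1 else 0)"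
proof (cases "(a, b) \<in> support")
  case True
  have "finite (rest (a, b))" using SVRPPD(2)[OF T0 c] by (simp add: rest_def)
  moreover have "rest (a, b) \<inter> entries \<kappa> (a, b) = {}"
    by (auto simp: rest_def entries_def)
  moreover have "card (entries \<kappa> (a, b)) = (if \<kappa> b = 2 * a + 1 then 2 else 1)"
  proof -
    consider "\<kappa> b = 2 * a + 1" | "2 * a + 1 < \<kappa> b" | "\<kappa> b < 2 * a + 1" by linarith
    then show ?thesis
    proof cases
      case 1
      then have "entries \<kappa> (a, b) = {i, i + 1}" by (auto simp: entries_def)
      then show ?thesis using 1 by simp
    next
      case 2
      then have "entries \<kappa> (a, b) = {i}" by (auto simp: entries_def)
      then show ?thesis using 2 by simp
    next
      case 3
      then have "entries \<kappa> (a, b) = {i + 1}" by (auto simp: entries_def)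
      then show ?thesis using 3 by simp
    qed
  qed
  ultimately show ?thesis
    using True c entries_props(3)[of \<kappa> "(a, b)"] by (simp add: filling_def card_Un_disjoint)
qed (use c in \<open>simp add: filling_def\<close>)

lemma ex_filling:
  assumes k: "\<kappa> \<in> keys"
  shows "ex D (filling \<kappa>) a =
    (\<Sum>b | (a, b) \<in> D. if (a, b) \<in> support then card (rest (a, b)) else card (rest (a, b)) - 1) +
    card {b \<in> cols. \<kappa> b = 2 * a + 1 \<and> lo b < 2 * a + 1 \<and> 2 * a + 1 < hi b}"
proof -
  have "{b. (a, b) \<in> D} \<subseteq> snd ` D" by force
  then have fin: "finite {b. (a, b) \<in> D}" using finD by (meson finite_imageI finite_subset)
  have "{b \<in> cols. \<kappa> b = 2 * a + 1 \<and> lo b < 2 * a + 1 \<and> 2 * a + 1 < hi b} =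
      {b \<in> {b. (a, b) \<in> D}. (a, b) \<in> support \<and> \<kappa> b = 2 * a + 1}"
    using support_subset by (auto simp: support_iff lo_def hi_def)
  then have "card {b \<in> cols. \<kappa> b = 2 * a + 1 \<and> lo b < 2 * a + 1 \<and> 2 * a + 1 < hi b} =
      (\<Sum>b | (a, b) \<in> D. if (a, b) \<in> support \<and> \<kappa> b = 2 * a + 1 then 1 else 0)"
    using sum.inter_filter[OF fin, of "\<lambda>_. 1 :: nat"] by simp
  moreover have "ex D (filling \<kappa>) a =
      (\<Sum>b | (a, b) \<in> D. (if (a, b) \<in> support then card (rest (a, b)) else card (rest (a, b)) - 1) +
        (if (a, b) \<in> support \<and> \<kappa> b = 2 * a + 1 then 1 else 0))"
    unfolding ex_def by (intro sum.cong refl card_filling) simp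
  ultimately show ?thesis by (simp only: sum.distrib)
qed

lemma ircont_filling_other:
  assumes "j \<noteq> i" "j \<noteq> i + 1"
  shows "ircont D (filling \<kappa>) j = card {b. \<exists>a. (a, b) \<in> D \<and> j \<in> rest (a, b)}"
proof -
  have "(a, b) \<in> D \<and> j \<in> filling \<kappa> (a, b) \<longleftrightarrow> (a, b) \<in> D \<and> j \<in> rest (a, b)" for a b
    using assms on_filling[of "(a, b)" j \<kappa>] by auto
  then show ?thesis by (simp only: ircont_def)
qed

text \<open>A column misses \<open>i\<close> exactly at the lower extremal key and
  \<open>i + 1\<close> exactly at the upper one. The top row is the first to receive
  \<open>i\<close>, the bottom row the first to receive \<open>i + 1\<close>, which gives the
  witnesses.\<close>

lemma ircont_filling:
  assumes k: "\<kappa> \<in> keys"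
  shows "ircont D (filling \<kappa>) i = card cols - card {b \<in> cols. \<kappa> b = lo b}"
    and "ircont D (filling \<kappa>) (i + 1) = card cols - card {b \<in> cols. \<kappa> b = hi b}"
proof -
  have mem: "(a, b) \<in> D \<and> j \<in> filling \<kappa> (a, b) \<longleftrightarrow> (a, b) \<in> support \<and> j \<in> entries \<kappa> (a, b)"
    if "j = i \<or> j = i + 1" for a b j
    using on_filling[of "(a, b)" j \<kappa>] that support_subset by auto
  have "(\<exists>a. (a, b) \<in> support \<and> i \<in> entries \<kappa> (a, b)) \<longleftrightarrow> b \<in> cols \<and> \<kappa> b \<noteq> lo b" for b
  proof
    assume "\<exists>a. (a, b) \<in> support \<and> i \<in> entries \<kappa> (a, b)"
    then show "b \<in> cols \<and> \<kappa> b \<noteq> lo b" by (auto simp: entries_def support_iff lo_def)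
  next
    assume b: "b \<in> cols \<and> \<kappa> b \<noteq> lo b"
    then have "(top_row b, b) \<in> support \<and> i \<in> entries \<kappa> (top_row b, b)"
      using keysD(1)[OF k, of b] top_le_bottom[of b] by (auto simp: entries_def support_iff lo_def)
    then show "\<exists>a. (a, b) \<in> support \<and> i \<in> entries \<kappa> (a, b)" by blast
  qed
  then have "{b. \<exists>a. (a, b) \<in> D \<and> i \<in> filling \<kappa> (a, b)} = cols - {b \<in> cols. \<kappa> b = lo b}"
    using mem[of i] by auto
  then show "ircont D (filling \<kappa>) i = card cols - card {b \<in> cols. \<kappa> b = lo b}"
    unfolding ircont_def using finite_cols by (simp add: card_Diff_subset)
  have "(\<exists>a. (a, b) \<in> support \<and> i + 1 \<in> entries \<kappa> (a, b)) \<longleftrightarrow> b \<in> cols \<and> \<kappa> b \<noteq> hi b" for b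
  proof
    assume "\<exists>a. (a, b) \<in> support \<and> i + 1 \<in> entries \<kappa> (a, b)"
    then show "b \<in> cols \<and> \<kappa> b \<noteq> hi b" by (auto simp: entries_def support_iff hi_def)
  next
    assume b: "b \<in> cols \<and> \<kappa> b \<noteq> hi b"
    then have "(bottom_row b, b) \<in> support \<and> i + 1 \<in> entries \<kappa> (bottom_row b, b)"
      using keysD(2)[OF k, of b] top_le_bottom[of b] by (auto simp: entries_def support_iff hi_def)
    then show "\<exists>a. (a, b) \<in> support \<and> i + 1 \<in> entries \<kappa> (a, b)" by blast
  qed
  then have "{b. \<exists>a. (a, b) \<in> D \<and> i + 1 \<in> filling \<kappa> (a, b)} = cols - {b \<in> cols. \<kappa> b = hi b}"
    using mem[of "i + 1"] by auto
  then show "ircont D (filling \<kappa>) (i + 1) = card cols - card {b \<in> cols. \<kappa> b = hi b}"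
    unfolding ircont_def using finite_cols by (simp add: card_Diff_subset)
qed

section \<open>Transfer of the involution to keys and to fillings\<close>

lemma keys_involution:
  "\<exists>f. involution_on keys f \<and> (\<forall>\<kappa> \<in> keys.
    card {b \<in> cols. f \<kappa> b = lo b} = card {b \<in> cols. \<kappa> b = hi b} \<and>
    card {b \<in> cols. f \<kappa> b = hi b} = card {b \<in> cols. \<kappa> b = lo b} \<and>
    (\<forall>k. card {b \<in> cols. f \<kappa> b = k \<and> lo b < k \<and> k < hi b} =
      card {b \<in> cols. \<kappa> b = k \<and> lo b < k \<and> k < hi b}))"
proof -
  let ?K = "decr_seqs cols lo hi 0"
  have "\<forall>b\<in>cols. lo b < hi b" using top_le_bottom by (force simp: lo_def hi_def)
  moreover have "\<forall>b\<in>cols. \<forall>b'\<in>cols. b < b' \<longrightarrow> lo b' \<le> lo b \<and> hi b' \<le> hi b"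
    using corner_rows_antitone by (simp add: lo_def hi_def)
  ultimately obtain f where f: "involution_on ?K f" and card: "\<forall>\<kappa> \<in> ?K.
      card {b \<in> cols. f \<kappa> b = lo b} = card {b \<in> cols. \<kappa> b = hi b} \<and>
      card {b \<in> cols. f \<kappa> b = hi b} = card {b \<in> cols. \<kappa> b = lo b} \<and>
      (\<forall>k. card {b \<in> cols. f \<kappa> b = k \<and> lo b < k \<and> k < hi b} =
        card {b \<in> cols. \<kappa> b = k \<and> lo b < k \<and> k < hi b})"
    using decr_seqs_involution[OF finite_cols, of lo hi] by blast
  \<comment> \<open>Both bounds are even, so an odd value is always interior. Membership in
    \<open>keys\<close> is thus visible in the interior counts, which \<open>f\<close>
    preserves.\<close>
  have keys_iff: "\<kappa> \<in> keys \<longleftrightarrow>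
      (\<forall>k. odd k \<longrightarrow> card {b \<in> cols. \<kappa> b = k \<and> lo b < k \<and> k < hi b} \<le> Suc 0)" if K: "\<kappa> \<in> ?K" for \<kappa>
  proof -
    have "{b \<in> cols. \<kappa> b = k \<and> lo b < k \<and> k < hi b} = {b \<in> cols. \<kappa> b = k}" if "odd k" for k
    proof -
      have "lo b < k \<and> k < hi b" if "b \<in> cols" "\<kappa> b = k" for b
      proof -
        have "lo b \<le> k" "k \<le> hi b" using K that by (auto simp: decr_seqs_def)
        moreover have "lo b \<noteq> k" "k \<noteq> hi b" using \<open>odd k\<close> by (auto simp: lo_def hi_def)
        ultimately show ?thesis by simp
      qed
      then show ?thesis by auto
    qed
    moreover have "card {b \<in> cols. \<kappa> b = k} \<le> Suc 0 \<longleftrightarrow>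
        (\<forall>b\<in>cols. \<forall>b'\<in>cols. \<kappa> b = k \<longrightarrow> \<kappa> b' = k \<longrightarrow> b = b')" for k
      using finite_cols by (subst card_le_Suc0_iff_eq) auto
    moreover have "\<kappa> \<in> keys \<longleftrightarrow>
        (\<forall>k. odd k \<longrightarrow> (\<forall>b\<in>cols. \<forall>b'\<in>cols. \<kappa> b = k \<longrightarrow> \<kappa> b' = k \<longrightarrow> b = b'))"
      using K unfolding keys_def by (auto, metis linorder_neqE_nat)
    ultimately show ?thesis by simp
  qed
  have sub: "keys \<subseteq> ?K" by (auto simp: keys_def)
  have "f \<kappa> \<in> keys" if "\<kappa> \<in> keys" for \<kappa>
  proof -
    have K: "\<kappa> \<in> ?K" using that sub by blast
    then have "f \<kappa> \<in> ?K" using f by (auto simp: involution_on_def)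
    then show ?thesis using keys_iff[OF K] keys_iff[of "f \<kappa>"] card K that by simp
  qed
  then have "involution_on keys f" using f sub by (auto simp: involution_on_def)
  then show ?thesis using card sub by blast
qed

text \<open>The involution on keys is conjugated by the bijection \<open>filling\<close>; the
  statistics see a key only through counts that are preserved or exchanged.\<close>

lemma class_involution:
  "\<exists>F. involution_on same_class F \<and> (\<forall>T\<in>same_class. ceq D (F T) = ceq D T \<and> ex D (F T) = ex D T \<and>
    ircont D (F T) = (ircont D T)(i := ircont D T (i + 1), i + 1 := ircont D T i))"
proof -
  obtain f where f: "involution_on keys f" and lo: "\<And>\<kappa>. \<kappa> \<in> keys \<Longrightarrow>
      card {b \<in> cols. f \<kappa> b = lo b} = card {b \<in> cols. \<kappa> b = hi b}"
    and hi: "\<And>\<kappa>. \<kappa> \<in> keys \<Longrightarrow> card {b \<in> cols. f \<kappa> b = hi b} = card {b \<in> cols. \<kappa> b = lo b}"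
    and mid: "\<And>\<kappa> k. \<kappa> \<in> keys \<Longrightarrow> card {b \<in> cols. f \<kappa> b = k \<and> lo b < k \<and> k < hi b} =
      card {b \<in> cols. \<kappa> b = k \<and> lo b < k \<and> k < hi b}"
    using keys_involution by blast
  define g where "g = inv_into keys filling"
  have g: "g T \<in> keys" "filling (g T) = T" if "T \<in> same_class" for T
    using that bij_filling unfolding g_def
    by (auto simp: bij_betw_inv_into_right inv_into_into bij_betw_def)
  have g_filling: "g (filling \<kappa>) = \<kappa>" if "\<kappa> \<in> keys" for \<kappa>
    using that bij_filling unfolding g_def by (simp add: bij_betw_inv_into_left)
  have fk: "f \<kappa> \<in> keys" "f (f \<kappa>) = \<kappa>" if "\<kappa> \<in> keys" for \<kappa>
    using f that by (auto simp: involution_on_def)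
  define F where "F T = filling (f (g T))" for T
  have "involution_on same_class F"
    unfolding involution_on_def F_def using g fk g_filling filling_in_class by auto
  moreover have "ceq D (F T) = ceq D T \<and> ex D (F T) = ex D T \<and>
      ircont D (F T) = (ircont D T)(i := ircont D T (i + 1), i + 1 := ircont D T i)"
    if T: "T \<in> same_class" for T
  proof -
    define \<kappa> where "\<kappa> = g T"
    have k: "\<kappa> \<in> keys" and T': "T = filling \<kappa>" and FT: "F T = filling (f \<kappa>)"
      using g[OF T] by (simp_all add: \<kappa>_def F_def)
    note fk = fk(1)[OF k]
    have "ceq D (filling (f \<kappa>)) a = ceq D (filling \<kappa>) a" for a
      by (simp only: ceq_filling[OF k] ceq_filling[OF fk] mid[OF k])
    moreover have "ex D (filling (f \<kappa>)) a = ex D (filling \<kappa>) a" for a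
      by (simp only: ex_filling[OF k] ex_filling[OF fk] mid[OF k])
    moreover have "ircont D (filling (f \<kappa>)) j =
        ((ircont D (filling \<kappa>))(i := ircont D (filling \<kappa>) (i + 1), i + 1 := ircont D (filling \<kappa>) i)) j" for j
    proof -
      consider "j = i" | "j = i + 1" | "j \<noteq> i" "j \<noteq> i + 1" by blast
      then show ?thesis
      proof cases
        case 1
        then show ?thesis using ircont_filling[OF k] ircont_filling[OF fk] lo[OF k] by simp
      next
        case 2
        then show ?thesis using ircont_filling[OF k] ircont_filling[OF fk] hi[OF k] by simp
      next
        case 3
        then show ?thesis by (simp add: ircont_filling_other)
      qed
    qed
    ultimately show ?thesis unfolding FT unfolding T' by (intro conjI ext)
  qed
  ultimately show ?thesis by blast
qed

end

text \<open>One involution is chosen for each value of \<open>c\<close>, not for each element, so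
  that an element and its image use the same one.\<close>

lemma involution_on_glue:
  assumes "\<And>x. x \<in> S \<Longrightarrow> \<exists>f. involution_on {y \<in> S. c y = c x} f \<and> (\<forall>y\<in>{y \<in> S. c y = c x}. P y (f y))"
  shows "\<exists>f. involution_on S f \<and> (\<forall>y\<in>S. P y (f y))"
proof -
  have "\<forall>v. \<exists>f. v \<in> c ` S \<longrightarrow> involution_on {y \<in> S. c y = v} f \<and> (\<forall>y\<in>{y \<in> S. c y = v}. P y (f y))"
    using assms by blast
  from choice[OF this]
  obtain f where f: "\<And>v. v \<in> c ` S \<Longrightarrow> involution_on {y \<in> S. c y = v} (f v)"
    "\<And>v y. v \<in> c ` S \<Longrightarrow> y \<in> S \<Longrightarrow> c y = v \<Longrightarrow> P y (f v y)"
    by blast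
  have "f (c y) y \<in> S \<and> c (f (c y) y) = c y \<and> f (c y) (f (c y) y) = y" if "y \<in> S" for y
    using f(1)[of "c y"] that by (auto simp: involution_on_def)
  then show ?thesis
    using f(2) by (intro exI[of _ "\<lambda>y. f (c y) y"]) (auto simp: involution_on_def)
qed

theorem theorem2p1:
  fixes lam mu :: "nat list" and i :: nat
  assumes "is_skew_shape lam mu" and "1 \<le> i"
  defines "D \<equiv> skew_diagram lam mu"
  shows "\<exists>\<Phi>. involution_on (SVRPP D) \<Phi> \<and>
    (\<forall>T \<in> SVRPP D.
       ceq D (\<Phi> T) = ceq D T \<and>
       ex D (\<Phi> T) = ex D T \<and>
       ircont D (\<Phi> T) = (ircont D T)(i := ircont D T (i + 1), i + 1 := ircont D T i))"
proof (rule involution_on_glue)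
  \<comment> \<open>This value records what a class holds fixed: the other entries of each box and
    whether it meets \<open>{i, i + 1}\<close>. Its fibres are the classes.\<close>
  let ?c = "\<lambda>T. \<lambda>c\<in>D. (T c - {i, i + 1}, T c \<inter> {i, i + 1} = {})"
  fix T0 assume T0: "T0 \<in> SVRPP D"
  interpret bender_knuth_class D T0 i
  proof
    show "finite D" unfolding D_def skew_diagram_def by (simp add: finite_diagram)
    show "order_convex D" unfolding D_def using assms(1) by (rule order_convex_skew_diagram)
  qed (use T0 assms(2) in auto)
  have "{T \<in> SVRPP D. ?c T = ?c T0} = same_class"
  proof -
    have "?c T = ?c T0 \<longleftrightarrow> (\<forall>c\<in>D. T c - {i, i + 1} = T0 c - {i, i + 1} \<and>
      (T c \<inter> {i, i + 1} = {} \<longleftrightarrow> T0 c \<inter> {i, i + 1} = {}))" for T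
      by (simp only: restrict_def fun_eq_iff) auto
    then show ?thesis by (simp only: same_class_def)
  qed
  then show "\<exists>F. involution_on {T \<in> SVRPP D. ?c T = ?c T0} F \<and>
    (\<forall>T\<in>{T \<in> SVRPP D. ?c T = ?c T0}. ceq D (F T) = ceq D T \<and> ex D (F T) = ex D T \<and>
      ircont D (F T) = (ircont D T)(i := ircont D T (i + 1), i + 1 := ircont D T i))"
    using class_involution by simp
qed

end
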